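(* Let $C>0$ be a constant. Let $G$ be a connected $(n,d,\lambda)$ graph (with $n \to \infty$) such that $\lambda \le C\sqrt{d}$ and $d \ge 2C\sqrt{n \ln^{1/9} n}$. Then for any vertex $v$ of $G$, with probability $1-o(1)$, $$|T(G,v) - (\log_2 n + \ln n)| = o(\ln n).$$
   Context: An $(n,d,\lambda)$ graph is a $d$-regular graph on $n$ vertices whose adjacency matrix has eigenvalues $\lambda_1 = d \ge \lambda_2 \ge \dots \ge \lambda_n$ (real, as the matrix is symmetric), with $\lambda := \max_{2 \le i \le n}|\lambda_i|$. Push model: initially only the vertex $v$ is informed; in each round every informed vertex independently chooses a neighbor uniformly at random and transmits the information to it. $T(G,v)$ is the number of rounds until all vertices are informed. The hypotheses hold for all sufficiently large $n$; asymptotic notation refers to $n \to \infty$, and the probability is over the random choices of the protocol. *)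

theory Defs
  imports "HOL-Probability.Probability" "Jordan_Normal_Form.Char_Poly"
    "HOL-Computational_Algebra.Polynomial"
begin

definition simple_graph :: "nat \<Rightarrow> (nat \<Rightarrow> nat \<Rightarrow> bool) \<Rightarrow> bool" where
  "simple_graph n E \<longleftrightarrow> (\<forall>i j. E i j \<longrightarrow> i < n \<and> j < n) \<and>
     (\<forall>i j. E i j \<longrightarrow> E j i) \<and> (\<forall>i. \<not> E i i)"

definition nbrs :: "(nat \<Rightarrow> nat \<Rightarrow> bool) \<Rightarrow> nat \<Rightarrow> nat set" where
  "nbrs E i = {j. E i j}"

definition regular :: "nat \<Rightarrow> (nat \<Rightarrow> nat \<Rightarrow> bool) \<Rightarrow> nat \<Rightarrow> bool" where
  "regular n E d \<longleftrightarrow> (\<forall>i<n. card (nbrs E i) = d)"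

definition connected_graph :: "nat \<Rightarrow> (nat \<Rightarrow> nat \<Rightarrow> bool) \<Rightarrow> bool" where
  "connected_graph n E \<longleftrightarrow> (\<forall>i<n. \<forall>j<n. E\<^sup>*\<^sup>* i j)"

definition adj_matrix :: "nat \<Rightarrow> (nat \<Rightarrow> nat \<Rightarrow> bool) \<Rightarrow> real mat" where
  "adj_matrix n E = mat n n (\<lambda>(i,j). if E i j then 1 else 0)"

text \<open>Eigenvalues (with multiplicity) of the adjacency matrix, sorted in non-increasing
  order: lambda_1 >= lambda_2 >= ... >= lambda_n. They are the roots of the characteristic
  polynomial; the matrix is real symmetric, so all of them are real.\<close>
definition adj_eigenvalues :: "nat \<Rightarrow> (nat \<Rightarrow> nat \<Rightarrow> bool) \<Rightarrow> real list" where
  "adj_eigenvalues n E = rev (sorted_list_of_multiset (proots (char_poly (adj_matrix n E))))"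

definition second_eig :: "nat \<Rightarrow> (nat \<Rightarrow> nat \<Rightarrow> bool) \<Rightarrow> real" where
  "second_eig n E = Max (abs ` set (tl (adj_eigenvalues n E)))"

text \<open>One round of randomness: every vertex independently picks a uniformly random
  neighbour (choices of uninformed vertices are simply not used).\<close>
definition round_choice :: "nat \<Rightarrow> (nat \<Rightarrow> nat \<Rightarrow> bool) \<Rightarrow> (nat \<Rightarrow> nat) pmf" where
  "round_choice n E = Pi_pmf {0..<n} 0 (\<lambda>u. pmf_of_set (nbrs E u))"

definition push_space :: "nat \<Rightarrow> (nat \<Rightarrow> nat \<Rightarrow> bool) \<Rightarrow> (nat \<Rightarrow> nat) stream measure" where
  "push_space n E = stream_space (measure_pmf (round_choice n E))"

primrec informed :: "nat \<Rightarrow> (nat \<Rightarrow> nat) stream \<Rightarrow> nat \<Rightarrow> nat set" where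
  "informed v \<omega> 0 = {v}"
| "informed v \<omega> (Suc t) = informed v \<omega> t \<union> (\<omega> !! t) ` informed v \<omega> t"

definition push_time :: "nat \<Rightarrow> nat \<Rightarrow> (nat \<Rightarrow> nat) stream \<Rightarrow> enat" where
  "push_time n v \<omega> =
     (if \<exists>t. informed v \<omega> t = {0..<n} then enat (LEAST t. informed v \<omega> t = {0..<n}) else \<infinity>)"

end

(*
  Upper bound: put eta = lambda / d, which tends to 0.  Since |A x| <= lambda |x| for vectors x of
  sum 0, the fraction of neighbours that a vertex u has in a set S of s vertices deviates from
  s / n by a total squared amount, over all u, of at most
  eta^2 s.  Hence one round turns s <= delta n informed vertices into (2 - O(delta)) s expected ones,
  shrinks an uninformed set of proportion between delta and 1 - delta by a constant factor, and
  shrinks an uninformed set of proportion at most delta by a factor e^(-1 + O(delta)).  Each of these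
  is a statement about the expectation of a potential after a single round, so the three phases,
  of lengths about log_2 n, o(ln n) and ln n, are each finished off by Markov's inequality.

  Lower bound: at least n / 2 vertices are uninformed after log_2 n - 1 rounds.  From then on let all
  vertices push.  A vertex stays unhit with probability (1 - 1/d)^d, about 1/e, in each round, and
  these events are negatively correlated for two vertices, so Chebyshev's inequality yields a
  survivor after (1 - o(1)) ln n rounds.
*)
theory Submission
  imports Defs "HOL-Real_Asymp.Real_Asymp"
begin

section \<open>The spectral gap\<close>

text \<open>No round is shown to be concentrated: controlling the deviation of each of about ln n
  rounds would be delicate while few vertices are informed, or few are left. Instead every phase has
  a potential whose expectation contracts by a fixed factor per round, and the factors multiply
  along the chain. For this, error terms must be proportional to the potential. That dictates three
  choices: the inverse of the number of informed vertices at the start, a potential cut off at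
  \<open>\<delta> * n\<close> in the middle, and at the end the variance bound for the uninformed
  set, whose error shrinks along with that set. The proportion \<delta> is chosen from \<epsilon>
  alone and fixed before \<eta> tends to 0, so terms such as
  \<open>\<eta>\<^sup>2 / \<delta>\<^sup>2\<close> vanish. The spectral input needs no
  diagonalisation: |Ax|^2 is maximised over the unit sphere of sum-zero vectors, and the maximiser
  yields a single eigenvalue that controls all of them.\<close>

definition adj :: "(nat \<Rightarrow> nat \<Rightarrow> bool) \<Rightarrow> nat \<Rightarrow> nat \<Rightarrow> real" where
  "adj E i j = of_bool (E i j)"

text \<open>Matrix-vector multiplication on functions rather than on \<open>vec\<close>: the
  extremal argument needs a topology on the vectors, and functions carry the product topology.
  Matrices return once an eigenvector has been found.\<close>

definition adj_sum :: "nat \<Rightarrow> (nat \<Rightarrow> nat \<Rightarrow> bool) \<Rightarrow> (nat \<Rightarrow> real) \<Rightarrow> nat \<Rightarrow> real" where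
  "adj_sum n E x i = (\<Sum>j<n. adj E i j * x j)"

definition dot :: "nat \<Rightarrow> (nat \<Rightarrow> real) \<Rightarrow> (nat \<Rightarrow> real) \<Rightarrow> real" where
  "dot n x y = (\<Sum>i<n. x i * y i)"

lemma dot_commute: "dot n x y = dot n y x"
  by (simp add: dot_def mult.commute)

lemma dot_self_nonneg: "0 \<le> dot n x x"
  by (auto simp: dot_def intro: sum_nonneg)

lemma dot_self_eq_0_iff: "dot n x x = 0 \<longleftrightarrow> (\<forall>i<n. x i = 0)"
  by (auto simp: dot_def sum_nonneg_eq_0_iff)

lemma dot_add_left: "dot n (\<lambda>i. x i + y i) z = dot n x z + dot n y z"
  by (simp add: dot_def algebra_simps sum.distrib)

lemma dot_diff_left: "dot n (\<lambda>i. x i - y i) z = dot n x z - dot n y z"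
  by (simp add: dot_def algebra_simps sum_subtractf)

lemma dot_scale_left: "dot n (\<lambda>i. c * x i) z = c * dot n x z"
  by (simp add: dot_def algebra_simps sum_distrib_left)

lemma dot_add_right: "dot n z (\<lambda>i. x i + y i) = dot n z x + dot n z y"
  by (simp add: dot_def algebra_simps sum.distrib)

lemma dot_scale_right: "dot n z (\<lambda>i. c * x i) = c * dot n z x"
  by (simp add: dot_def algebra_simps sum_distrib_left)

lemmas dot_linear = dot_add_left dot_diff_left dot_scale_left dot_add_right dot_scale_right

lemma adj_sum_add: "adj_sum n E (\<lambda>i. x i + y i) = (\<lambda>i. adj_sum n E x i + adj_sum n E y i)"
  by (simp add: adj_sum_def fun_eq_iff algebra_simps sum.distrib)

lemma adj_sum_scale: "adj_sum n E (\<lambda>i. c * x i) = (\<lambda>i. c * adj_sum n E x i)"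
  by (simp add: adj_sum_def fun_eq_iff sum_distrib_left algebra_simps)

lemma dot_adj_sum:
  assumes "simple_graph n E"
  shows "dot n (adj_sum n E x) y = dot n x (adj_sum n E y)"
proof -
  have E: "adj E i j = adj E j i" for i j
    using assms by (auto simp: simple_graph_def adj_def)
  have "dot n (adj_sum n E x) y = (\<Sum>i<n. \<Sum>j<n. adj E i j * x j * y i)"
    by (simp add: dot_def adj_sum_def sum_distrib_right)
  also have "\<dots> = (\<Sum>j<n. \<Sum>i<n. adj E i j * x j * y i)"
    by (rule sum.swap)
  also have "\<dots> = dot n x (adj_sum n E y)"
    by (simp add: dot_def adj_sum_def sum_distrib_left E algebra_simps)
  finally show ?thesis .
qed

lemma adj_sum_const:
  assumes "simple_graph n E" "regular n E d" "i < n"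
  shows "adj_sum n E (\<lambda>_. c) i = real d * c"
proof -
  have "nbrs E i \<subseteq> {..<n}"
    using assms by (auto simp: simple_graph_def nbrs_def)
  then have "{j \<in> {..<n}. E i j} = nbrs E i"
    by (auto simp: nbrs_def)
  then have "(\<Sum>j<n. adj E i j) = card (nbrs E i)"
    by (simp add: adj_def of_bool_def sum.If_cases Int_def)
  then show ?thesis
    using assms by (simp add: adj_sum_def regular_def flip: sum_distrib_right)
qed

lemma sum_adj_sum:
  assumes "simple_graph n E" "regular n E d"
  shows "(\<Sum>i<n. adj_sum n E x i) = real d * (\<Sum>i<n. x i)"
proof -
  have "(\<Sum>i<n. adj_sum n E x i) = dot n (adj_sum n E x) (\<lambda>_. 1)"
    by (simp add: dot_def)
  also have "\<dots> = (\<Sum>i<n. x i * (real d * 1))"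
    unfolding dot_adj_sum[OF assms(1)] using adj_sum_const[OF assms, of _ 1] by (simp add: dot_def)
  finally show ?thesis
    by (simp add: sum_distrib_left mult.commute)
qed

section \<open>Sum-zero vectors and an extremal eigenvector\<close>

definition zero_sum_vecs :: "nat \<Rightarrow> (nat \<Rightarrow> real) set" where
  "zero_sum_vecs n = {x. (\<forall>i\<ge>n. x i = 0) \<and> (\<Sum>i<n. x i) = 0}"

lemma zero_sum_vecs_add:
  "x \<in> zero_sum_vecs n \<Longrightarrow> y \<in> zero_sum_vecs n \<Longrightarrow> (\<lambda>i. x i + y i) \<in> zero_sum_vecs n"
  by (auto simp: zero_sum_vecs_def sum.distrib)

lemma zero_sum_vecs_scale:
  "x \<in> zero_sum_vecs n \<Longrightarrow> (\<lambda>i. c * x i) \<in> zero_sum_vecs n"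
  by (auto simp: zero_sum_vecs_def simp flip: sum_distrib_left)

lemma adj_sum_zero_sum_vecs:
  assumes "simple_graph n E" "regular n E d" "x \<in> zero_sum_vecs n"
  shows "adj_sum n E x \<in> zero_sum_vecs n"
proof -
  have "adj_sum n E x i = 0" if "i \<ge> n" for i
    using that assms(1) unfolding adj_sum_def adj_def simple_graph_def
    by (intro sum.neutral) (auto, metis leD)
  with assms sum_adj_sum[OF assms(1,2), of x] show ?thesis
    by (auto simp: zero_sum_vecs_def)
qed

text \<open>All coordinates of a unit vector lie in [-1, 1], so this is a closed subset of a cube
  that is compact by Tychonoff. Since \<open>dot n\<close> does not see the coordinates from
  \<open>n\<close> on, it matters that \<open>zero_sum_vecs\<close> sets them to 0.\<close>

lemma compact_zero_sum_sphere: "compact {x \<in> zero_sum_vecs n. dot n x x = 1}"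
proof -
  have "compactin (product_topology (\<lambda>i. euclidean) UNIV) (PiE (UNIV :: nat set) (\<lambda>_. {-1..1::real}))"
    by (simp add: compactin_PiE)
  then have cpt: "compact (PiE (UNIV :: nat set) (\<lambda>_. {-1..1::real}))"
    by (simp add: euclidean_product_topology)
  have coord: "continuous_on UNIV (\<lambda>x :: nat \<Rightarrow> real. x i)" for i
    by simp
  have "closed {x :: nat \<Rightarrow> real. (\<Sum>i<n. x i) = 0}"
    by (intro closed_Collect_eq continuous_intros coord)
  moreover have "closed {x :: nat \<Rightarrow> real. dot n x x = 1}"
    unfolding dot_def by (intro closed_Collect_eq continuous_intros coord)
  moreover have "closed {x :: nat \<Rightarrow> real. \<forall>i\<in>{n..}. x i = 0}"
    unfolding Ball_def by (intro closed_Collect_all closed_Collect_imp closed_Collect_eq continuous_intros coord open_Collect_const)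
  ultimately have clo: "closed ({x :: nat \<Rightarrow> real. (\<Sum>i<n. x i) = 0} \<inter> {x. dot n x x = 1}
      \<inter> {x. \<forall>i\<in>{n..}. x i = 0})"
    by blast
  have "x i \<in> {-1..1}" if "dot n x x = 1" "\<forall>i\<ge>n. x i = 0" for x :: "nat \<Rightarrow> real" and i
  proof (cases "i < n")
    case True
    have "x i * x i \<le> dot n x x"
      unfolding dot_def using True by (intro member_le_sum) auto
    with that show ?thesis
      by (simp add: abs_le_square_iff[of _ 1, simplified] power2_eq_square flip: abs_le_iff)
         (metis abs_le_iff abs_square_le_1 neg_le_iff_le minus_minus power2_eq_square)
  qed (use that in auto)
  then have eq: "{x \<in> zero_sum_vecs n. dot n x x = 1} = PiE UNIV (\<lambda>_. {-1..1}) \<inter>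
      ({x. (\<Sum>i<n. x i) = 0} \<inter> {x. dot n x x = 1} \<inter> {x. \<forall>i\<in>{n..}. x i = 0})"
    by (auto simp: zero_sum_vecs_def PiE_def Pi_def)
  show ?thesis
    unfolding eq by (rule compact_Int_closed[OF cpt clo])
qed

text \<open>A quadratic that vanishes at 0 and is nowhere negative has derivative 0 there. This is
  the first-order condition at the maximum in \<open>rayleigh_maximiser\<close>.\<close>

lemma psd_linear_term_zero:
  fixes b q :: real
  assumes "\<And>t. 0 \<le> 2 * t * b + t\<^sup>2 * q"
  shows "b = 0"
proof (rule ccontr)
  assume "b \<noteq> 0"
  \<comment> \<open>The minimiser would be \<open>- b / q\<close>; enlarging the denominator to
    \<open>\<bar>q\<bar> + 1\<close> covers every sign of \<open>q\<close> and still lets the linear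
    term dominate.\<close>
  define t where "t = - b / (\<bar>q\<bar> + 1)"
  have "t\<^sup>2 * q \<le> t\<^sup>2 * (\<bar>q\<bar> + 1)"
    by (intro mult_left_mono) auto
  also have "\<dots> = - t * b"
    by (simp add: t_def power2_eq_square add_nonneg_eq_0_iff)
  finally have "2 * t * b + t\<^sup>2 * q \<le> t * b"
    by (simp only: mult_2 distrib_right mult_minus_left)
  also have "t * b < 0"
    using \<open>b \<noteq> 0\<close> by (auto simp: t_def zero_less_divide_iff zero_less_mult_iff)
  finally show False
    using assms[of t] by simp
qed

text \<open>Maximising |Ax|^2 instead of the form x . Ax treats both ends of the spectrum at once;
  the price is that the maximiser is an eigenvector of the square of A only. The assumption
  \<open>n \<ge> 2\<close> makes the sphere nonempty.\<close>

lemma rayleigh_maximiser: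
  assumes G: "simple_graph n E" "regular n E d" and "n \<ge> 2"
  obtains x M where "x \<in> zero_sum_vecs n" "dot n x x = 1"
    "\<And>i. i < n \<Longrightarrow> adj_sum n E (adj_sum n E x) i = M * x i"
    "\<And>y. y \<in> zero_sum_vecs n \<Longrightarrow> dot n (adj_sum n E y) (adj_sum n E y) \<le> M * dot n y y"
proof -
  let ?A = "adj_sum n E" and ?W = "zero_sum_vecs n"
  let ?K = "{x \<in> ?W. dot n x x = 1}"
  \<comment> \<open>The normalised difference of the first two unit vectors.\<close>
  let ?x = "\<lambda>i::nat. if i = 0 then sqrt (1/2) else if i = 1 then - sqrt (1/2) else 0"
  have n: "{..<n} = {0,1} \<union> {2..<n}"
    using \<open>n \<ge> 2\<close> by auto
  have "(\<Sum>i<n. ?x i) = 0" "dot n ?x ?x = 1"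
    unfolding dot_def by (simp_all add: n sum.union_disjoint)
  then have "?x \<in> ?K"
    using \<open>n \<ge> 2\<close> by (simp add: zero_sum_vecs_def)
  then have "?K \<noteq> {}"
    by blast
  moreover have "continuous_on ?K (\<lambda>x. dot n (?A x) (?A x))"
    unfolding dot_def adj_sum_def
    by (intro continuous_intros continuous_on_subset[OF continuous_on_product_coordinates] subset_UNIV)
  ultimately obtain x where x: "x \<in> ?W" "dot n x x = 1"
    and max: "\<And>y. y \<in> ?K \<Longrightarrow> dot n (?A y) (?A y) \<le> dot n (?A x) (?A x)"
    using continuous_attains_sup[OF compact_zero_sum_sphere] by blast
  define M where "M = dot n (?A x) (?A x)"
  have bound: "dot n (?A y) (?A y) \<le> M * dot n y y" if y: "y \<in> ?W" for y
  proof (cases "dot n y y = 0")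
    case True
    then have "\<forall>i<n. y i = 0"
      by (simp add: dot_self_eq_0_iff)
    then show ?thesis
      by (simp add: dot_def adj_sum_def)
  next
    case False
    then have pos: "dot n y y > 0"
      using dot_self_nonneg[of n y] by simp
    define c where "c = 1 / sqrt (dot n y y)"
    have c: "c * (c * r) = r / dot n y y" for r
      using pos by (simp add: c_def)
    have "(\<lambda>i. c * y i) \<in> ?K"
      using y pos by (simp add: zero_sum_vecs_scale dot_linear c)
    from max[OF this] have "dot n (?A y) (?A y) / dot n y y \<le> M"
      by (simp add: adj_sum_scale dot_linear c M_def)
    then show ?thesis
      using pos by (simp add: field_simps)
  qed
  \<comment> \<open>The residual of the eigenvalue equation. It lies in the sum-zero space itself,
    so being orthogonal to that space forces it to vanish.\<close>
  define z where "z = (\<lambda>i. M * x i + (-1) * ?A (?A x) i)"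
  have z: "z \<in> ?W"
    unfolding z_def using x G
    by (intro zero_sum_vecs_add zero_sum_vecs_scale adj_sum_zero_sum_vecs)
  \<comment> \<open>Move from \<open>x\<close> to \<open>x + t * y\<close>. The constant terms of
    the two sides cancel because \<open>x\<close> attains the maximum, which leaves a nonnegative
    quadratic in \<open>t\<close> with linear coefficient \<open>2 * dot n z y\<close>.\<close>
  have orth: "dot n z y = 0" if y: "y \<in> ?W" for y
  proof (rule psd_linear_term_zero)
    fix t
    have "dot n (?A (\<lambda>i. x i + t * y i)) (?A (\<lambda>i. x i + t * y i))
        \<le> M * dot n (\<lambda>i. x i + t * y i) (\<lambda>i. x i + t * y i)"
      by (intro bound zero_sum_vecs_add zero_sum_vecs_scale x y)
    then have "0 \<le> 2 * t * (M * dot n x y - dot n (?A x) (?A y))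
        + t\<^sup>2 * (M * dot n y y - dot n (?A y) (?A y))"
      unfolding adj_sum_add adj_sum_scale dot_linear M_def[symmetric] x(2)
        dot_commute[of n y x] dot_commute[of n "?A y" "?A x"]
      by (simp add: algebra_simps power2_eq_square)
    also have "M * dot n x y - dot n (?A x) (?A y) = dot n z y"
      unfolding z_def dot_linear dot_adj_sum[OF G(1), of "?A x" y] by simp
    finally show "0 \<le> 2 * t * dot n z y + t\<^sup>2 * (M * dot n y y - dot n (?A y) (?A y))" .
  qed
  have "\<forall>i<n. z i = 0"
    using orth[OF z] by (simp add: dot_self_eq_0_iff)
  then have "\<And>i. i < n \<Longrightarrow> ?A (?A x) i = M * x i"
    by (simp add: z_def)
  with x bound show thesis
    by (intro that)
qed

text \<open>A^2 - M factors as (A - sqrt M)(A + sqrt M). Hence (A + sqrt M) x is an eigenvector for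
  sqrt M, unless it is zero, and then \<open>x\<close> is one for - sqrt M.\<close>

lemma zero_sum_eigenvector:
  assumes G: "simple_graph n E" "regular n E d" and "n \<ge> 2"
  obtains x \<nu> where "x \<in> zero_sum_vecs n" "dot n x x \<noteq> 0"
    "\<And>i. i < n \<Longrightarrow> adj_sum n E x i = \<nu> * x i"
    "\<And>y. y \<in> zero_sum_vecs n \<Longrightarrow> dot n (adj_sum n E y) (adj_sum n E y) \<le> \<nu>\<^sup>2 * dot n y y"
proof -
  let ?A = "adj_sum n E"
  obtain x M where x: "x \<in> zero_sum_vecs n" "dot n x x = 1"
    and AA: "\<And>i. i < n \<Longrightarrow> ?A (?A x) i = M * x i"
    and bound: "\<And>y. y \<in> zero_sum_vecs n \<Longrightarrow> dot n (?A y) (?A y) \<le> M * dot n y y"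
    using rayleigh_maximiser[OF assms] by blast
  have M: "M \<ge> 0"
    using bound[OF x(1)] dot_self_nonneg[of n "?A x"] x(2) by simp
  define y where "y = (\<lambda>i. ?A x i + sqrt M * x i)"
  have y: "y \<in> zero_sum_vecs n"
    unfolding y_def using x G by (intro zero_sum_vecs_add zero_sum_vecs_scale adj_sum_zero_sum_vecs)
  have Ay: "?A y i = sqrt M * y i" if "i < n" for i
    using AA[OF that] M by (simp add: y_def adj_sum_add adj_sum_scale algebra_simps)
  show thesis
  proof (cases "dot n y y = 0")
    case True
    then have "?A x i = - sqrt M * x i" if "i < n" for i
      using that by (simp add: dot_self_eq_0_iff y_def eq_neg_iff_add_eq_0)
    with x bound M show thesis
      by (intro that[of x "- sqrt M"]) auto
  next
    case False
    with y Ay bound M show thesis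
      by (intro that[of y "sqrt M"]) auto
  qed
qed

section \<open>From the extremal vector to \<open>second_eig\<close>\<close>

lemma eigenvalue_adj_matrix:
  assumes "\<And>i. i < n \<Longrightarrow> adj_sum n E x i = \<nu> * x i" "i < n" "x i \<noteq> 0"
  shows "eigenvalue (adj_matrix n E) \<nu>"
  unfolding eigenvalue_def eigenvector_def
proof (intro exI conjI)
  let ?v = "vec n x"
  show "?v \<in> carrier_vec (dim_row (adj_matrix n E))"
    by (simp add: adj_matrix_def)
  show "?v \<noteq> 0\<^sub>v (dim_row (adj_matrix n E))"
  proof
    assume "?v = 0\<^sub>v (dim_row (adj_matrix n E))"
    then have "vec_index ?v i = 0"
      using assms by (simp add: adj_matrix_def)
    with assms show False by simp
  qed
  show "adj_matrix n E *\<^sub>v ?v = \<nu> \<cdot>\<^sub>v ?v"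
  proof (rule eq_vecI)
    fix i assume "i < dim_vec (\<nu> \<cdot>\<^sub>v ?v)"
    then have i: "i < n" by simp
    then have "vec_index (adj_matrix n E *\<^sub>v ?v) i = adj_sum n E x i"
      by (simp add: adj_matrix_def adj_sum_def adj_def of_bool_def scalar_prod_def atLeast0LessThan
          del: sum_mult_of_bool_eq sum_of_bool_mult_eq)
    with i show "vec_index (adj_matrix n E *\<^sub>v ?v) i = vec_index (\<nu> \<cdot>\<^sub>v ?v) i"
      by (simp add: assms)
  qed (simp add: adj_matrix_def)
qed

lemma set_adj_eigenvalues: "set (adj_eigenvalues n E) = {\<nu>. eigenvalue (adj_matrix n E) \<nu>}"
proof -
  have A: "adj_matrix n E \<in> carrier_mat n n"
    by (simp add: adj_matrix_def)
  then have "char_poly (adj_matrix n E) \<noteq> 0"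
    using degree_monic_char_poly[OF A] by auto
  then show ?thesis
    by (simp add: adj_eigenvalues_def eigenvalue_root_char_poly[OF A])
qed

text \<open>Every adjacency eigenvalue different from the largest one occurs in the tail of the
  sorted list.\<close>
lemma abs_le_second_eig:
  assumes "eigenvalue (adj_matrix n E) \<nu>" "eigenvalue (adj_matrix n E) \<mu>" "\<nu> < \<mu>"
  shows "\<bar>\<nu>\<bar> \<le> second_eig n E"
proof -
  let ?l = "adj_eigenvalues n E"
  have in_l: "\<nu> \<in> set ?l" "\<mu> \<in> set ?l"
    using assms by (simp_all add: set_adj_eigenvalues)
  then obtain a l where l: "?l = a # l"
    by (cases ?l) auto
  have "sorted (rev ?l)"
    by (simp add: adj_eigenvalues_def)
  then have "\<forall>x\<in>set l. x \<le> a"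
    by (simp add: l sorted_append)
  with in_l assms(3) have "\<nu> \<in> set l"
    by (auto simp: l)
  then show ?thesis
    by (simp add: second_eig_def l)
qed

text \<open>On a connected graph the only harmonic functions are the constants, so \<open>d\<close> is not an
  eigenvalue on the sum-zero vectors.\<close>
lemma zero_sum_eigenvalue_less:
  assumes G: "simple_graph n E" "connected_graph n E" "regular n E d"
    and x: "x \<in> zero_sum_vecs n" "dot n x x \<noteq> 0"
    and ev: "\<And>i. i < n \<Longrightarrow> adj_sum n E x i = \<nu> * x i"
  shows "\<nu> < real d"
proof -
  have Esym: "adj E i j = adj E j i" for i j
    using G by (auto simp: simple_graph_def adj_def)
  \<comment> \<open>Twice the quadratic form of the Laplacian d - A, as the sum runs over ordered
    pairs. On an eigenvector it equals \<open>2 * (real d - \<nu>) * dot n x x\<close>, and it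
    vanishes exactly when \<open>x\<close> is constant along edges.\<close>
  define Q where "Q = (\<Sum>i<n. \<Sum>j<n. adj E i j * (x i - x j)\<^sup>2)"
  have row: "(\<Sum>j<n. adj E i j) = real d" if "i < n" for i
    using adj_sum_const[OF G(1,3) that, of 1] by (simp add: adj_sum_def)
  have "Q = (\<Sum>i<n. \<Sum>j<n. adj E i j * (x i)\<^sup>2) + (\<Sum>i<n. \<Sum>j<n. adj E i j * (x j)\<^sup>2)
      - 2 * (\<Sum>i<n. \<Sum>j<n. adj E i j * (x i * x j))"
    by (simp add: Q_def power2_eq_square algebra_simps sum.distrib sum_subtractf sum_distrib_left)
  also have "(\<Sum>i<n. \<Sum>j<n. adj E i j * (x j)\<^sup>2) = (\<Sum>i<n. \<Sum>j<n. adj E i j * (x i)\<^sup>2)"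
    by (subst sum.swap) (simp add: Esym)
  also have "(\<Sum>i<n. \<Sum>j<n. adj E i j * (x i)\<^sup>2) = real d * dot n x x"
    by (simp add: dot_def row power2_eq_square sum_distrib_left flip: sum_distrib_right)
  also have "(\<Sum>i<n. \<Sum>j<n. adj E i j * (x i * x j)) = dot n x (adj_sum n E x)"
    by (simp add: dot_def adj_sum_def sum_distrib_left algebra_simps)
  also have "\<dots> = \<nu> * dot n x x"
    by (simp add: dot_def ev sum_distrib_left algebra_simps)
  finally have Q: "Q = 2 * (real d - \<nu>) * dot n x x"
    by (simp add: algebra_simps)
  have "Q \<noteq> 0"
  proof
    assume "Q = 0"
    then have edge: "x i = x j" if "E i j" for i j
    proof -
      have ij: "i < n" "j < n"
        using that G by (auto simp: simple_graph_def)
      have "(\<Sum>j<n. adj E i j * (x i - x j)\<^sup>2) = 0"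
        using \<open>Q = 0\<close> ij unfolding Q_def
        by (subst (asm) sum_nonneg_eq_0_iff) (auto intro: sum_nonneg simp: adj_def)
      then have "adj E i j * (x i - x j)\<^sup>2 = 0"
        using ij by (subst (asm) sum_nonneg_eq_0_iff) (auto simp: adj_def)
      with that show ?thesis by (simp add: adj_def)
    qed
    have "x i = x 0" if "i < n" for i
    proof -
      have "E\<^sup>*\<^sup>* i 0"
        using G(2) that by (auto simp: connected_graph_def)
      then show ?thesis
        by (induction rule: rtranclp_induct) (auto dest: edge)
    qed
    then have "(\<Sum>i<n. x i) = (\<Sum>i<n. x 0)" "dot n x x = (\<Sum>i<n. x 0 * x 0)"
      unfolding dot_def by (intro sum.cong refl; metis lessThan_iff)+
    with x show False
      by (auto simp: zero_sum_vecs_def)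
  qed
  moreover have "Q \<ge> 0"
    unfolding Q_def by (intro sum_nonneg) (auto simp: adj_def)
  ultimately have "0 < (real d - \<nu>) * dot n x x"
    using Q by (simp only: mult.assoc zero_less_mult_iff less_le) auto
  with dot_self_nonneg[of n x] show ?thesis
    by (simp add: zero_less_mult_iff)
qed

text \<open>The extremal \<nu> and \<open>d\<close>, the eigenvalue of the constant vector, are two
  different eigenvalues with \<open>\<nu> < d\<close>, so \<nu> cannot be the head of the sorted
  list. Strictness, which comes from connectivity, removes any need to count multiplicities.\<close>

theorem adj_sum_norm_le:
  assumes G: "simple_graph n E" "connected_graph n E" "regular n E d" "n \<ge> 2"
    and \<Lambda>: "second_eig n E \<le> \<Lambda>" and y: "y \<in> zero_sum_vecs n"
  shows "dot n (adj_sum n E y) (adj_sum n E y) \<le> \<Lambda>\<^sup>2 * dot n y y"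
proof -
  obtain x \<nu> where x: "x \<in> zero_sum_vecs n" "dot n x x \<noteq> 0"
    and ev: "\<And>i. i < n \<Longrightarrow> adj_sum n E x i = \<nu> * x i"
    and bound: "\<And>y. y \<in> zero_sum_vecs n \<Longrightarrow>
      dot n (adj_sum n E y) (adj_sum n E y) \<le> \<nu>\<^sup>2 * dot n y y"
    using zero_sum_eigenvector[OF G(1,3,4)] by blast
  obtain i where "i < n" "x i \<noteq> 0"
    using x(2) by (auto simp: dot_self_eq_0_iff)
  then have "eigenvalue (adj_matrix n E) \<nu>"
    using ev by (intro eigenvalue_adj_matrix)
  moreover have "eigenvalue (adj_matrix n E) (real d)"
    using \<open>i < n\<close> adj_sum_const[OF G(1,3), of _ 1]
    by (intro eigenvalue_adj_matrix[where x = "\<lambda>_. 1"]) auto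
  moreover have "\<nu> < real d"
    using zero_sum_eigenvalue_less[OF G(1-3) x ev] by simp
  ultimately have "\<bar>\<nu>\<bar> \<le> second_eig n E"
    by (rule abs_le_second_eig)
  then have "\<nu>\<^sup>2 \<le> \<Lambda>\<^sup>2"
    using \<Lambda> by (metis abs_ge_zero order_trans power2_abs power_mono)
  with bound[OF y] dot_self_nonneg[of n y] show ?thesis
    by (meson mult_right_mono order_trans)
qed

text \<open>The norm bound is applied to the indicator of \<open>S\<close> centred at its mean
  \<open>m\<close>. The matrix sends the constant part to \<open>d * m\<close>, and the centred
  indicator has squared norm \<open>card S * (1 - m)\<close>.\<close>

lemma degree_into_variance:
  assumes G: "simple_graph n E" "connected_graph n E" "regular n E d" "n \<ge> 2"
    and \<Lambda>: "second_eig n E \<le> \<Lambda>" and S: "S \<subseteq> {..<n}"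
  shows "(\<Sum>u<n. (real (card (nbrs E u \<inter> S)) - real d * real (card S) / real n)\<^sup>2)
    \<le> \<Lambda>\<^sup>2 * real (card S)"
proof -
  define m where "m = real (card S) / real n"
  define y where "y = (\<lambda>i. if i < n then of_bool (i \<in> S) - m else 0)"
  have "{..<n} \<inter> S = S"
    using S by auto
  then have cS: "(\<Sum>i<n. of_bool (i \<in> S) :: real) = card S"
    by (simp add: of_bool_def sum.If_cases)
  have y: "y \<in> zero_sum_vecs n"
    using \<open>n \<ge> 2\<close> cS by (simp add: zero_sum_vecs_def y_def sum_subtractf m_def)
  have "adj_sum n E y u = real (card (nbrs E u \<inter> S)) - real d * m" if "u < n" for u
  proof -
    have "adj_sum n E y u = (\<Sum>j<n. of_bool (E u j \<and> j \<in> S)) - adj_sum n E (\<lambda>_. m) u"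
      unfolding adj_sum_def y_def sum_subtractf[symmetric]
      by (intro sum.cong) (auto simp: adj_def)
    also have "(\<Sum>j<n. of_bool (E u j \<and> j \<in> S) :: real) = card (nbrs E u \<inter> S)"
    proof -
      have "{j \<in> {..<n}. E u j \<and> j \<in> S} = nbrs E u \<inter> S"
        using S by (auto simp: nbrs_def)
      then show ?thesis
        by (simp add: of_bool_def sum.If_cases Int_def)
    qed
    finally show ?thesis
      by (simp add: adj_sum_const[OF G(1,3) that])
  qed
  then have "(\<Sum>u<n. (real (card (nbrs E u \<inter> S)) - real d * real (card S) / real n)\<^sup>2)
      = dot n (adj_sum n E y) (adj_sum n E y)"
    by (simp add: dot_def m_def power2_eq_square)
  also have "\<dots> \<le> \<Lambda>\<^sup>2 * dot n y y"
    by (rule adj_sum_norm_le[OF G \<Lambda> y])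
  also have "dot n y y \<le> real (card S)"
  proof -
    \<comment> \<open>For b equal to 0 or 1, (b - m)^2 = b (1 - 2 m) + m^2.\<close>
    have "dot n y y = (\<Sum>i<n. of_bool (i \<in> S) * (1 - 2 * m) + m * m)"
      unfolding dot_def y_def by (intro sum.cong) (auto simp: algebra_simps)
    also have "\<dots> = real (card S) * (1 - 2 * m) + real n * (m * m)"
      by (simp add: sum.distrib cS flip: sum_distrib_right)
    also have "real n * (m * m) = real (card S) * m"
      using \<open>n \<ge> 2\<close> by (simp add: m_def)
    also have "real (card S) * (1 - 2 * m) + real (card S) * m = real (card S) * (1 - m)"
      by (simp add: algebra_simps)
    also have "\<dots> \<le> real (card S) * 1"
      by (intro mult_left_mono) (simp_all add: m_def)
    finally show ?thesis
      by simp
  qed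
  finally show ?thesis
    by (simp add: mult_left_mono)
qed

section \<open>Markov chains and the push process\<close>

primrec run_pmf :: "'f pmf \<Rightarrow> ('s \<Rightarrow> 'f \<Rightarrow> 's) \<Rightarrow> 's \<Rightarrow> nat \<Rightarrow> 's pmf" where
  "run_pmf p \<sigma> s 0 = return_pmf s"
| "run_pmf p \<sigma> s (Suc t) = bind_pmf p (\<lambda>f. run_pmf p \<sigma> (\<sigma> s f) t)"

lemma run_pmf_add: "run_pmf p \<sigma> s (a + b) = bind_pmf (run_pmf p \<sigma> s a) (\<lambda>s'. run_pmf p \<sigma> s' b)"
  by (induction a arbitrary: s) (simp_all add: bind_return_pmf bind_assoc_pmf)

lemma finite_set_run_pmf: "finite (set_pmf p) \<Longrightarrow> finite (set_pmf (run_pmf p \<sigma> s t))"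
  by (induction t arbitrary: s) auto

lemma run_pmf_invariant:
  assumes "\<And>s f. I s \<Longrightarrow> f \<in> set_pmf p \<Longrightarrow> I (\<sigma> s f)" "I s" "s' \<in> set_pmf (run_pmf p \<sigma> s t)"
  shows "I s'"
  using assms(2,3) by (induction t arbitrary: s) (auto dest: assms(1))

lemma expectation_mono_pmf:
  fixes f g :: "'a \<Rightarrow> real"
  assumes "finite (set_pmf p)" "\<And>x. x \<in> set_pmf p \<Longrightarrow> f x \<le> g x"
  shows "measure_pmf.expectation p f \<le> measure_pmf.expectation p g"
  using assms by (intro integral_mono_AE integrable_measure_pmf_finite) (auto simp: AE_measure_pmf_iff)

lemma expectation_bind_pmf:
  fixes h :: "'b \<Rightarrow> real"
  assumes "finite (set_pmf p)" "\<And>x. x \<in> set_pmf p \<Longrightarrow> finite (set_pmf (q x))"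
  shows "measure_pmf.expectation (bind_pmf p q) h
    = measure_pmf.expectation p (\<lambda>x. measure_pmf.expectation (q x) h)"
  using assms by (subst pmf_expectation_bind[of "set_pmf p"]) (auto simp: integral_measure_pmf[of "set_pmf p"])

text \<open>The supermartingale argument behind all phases. The invariant \<open>I\<close> records
  what a phase may assume about its current state, so that the one-round estimate is required only
  there.\<close>

lemma expectation_run_pmf_le:
  fixes g :: "'s \<Rightarrow> real"
  assumes fin: "finite (set_pmf p)" and "0 \<le> \<rho>"
    and inv: "\<And>s f. I s \<Longrightarrow> f \<in> set_pmf p \<Longrightarrow> I (\<sigma> s f)"
    and step: "\<And>s. I s \<Longrightarrow> measure_pmf.expectation p (\<lambda>f. g (\<sigma> s f)) \<le> \<rho> * g s"
    and "I s"
  shows "measure_pmf.expectation (run_pmf p \<sigma> s t) g \<le> \<rho> ^ t * g s"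
  using \<open>I s\<close>
proof (induction t arbitrary: s)
  case (Suc t)
  have "measure_pmf.expectation (run_pmf p \<sigma> s (Suc t)) g
      = measure_pmf.expectation p (\<lambda>f. measure_pmf.expectation (run_pmf p \<sigma> (\<sigma> s f) t) g)"
    using fin by (simp add: expectation_bind_pmf finite_set_run_pmf)
  also have "\<dots> \<le> measure_pmf.expectation p (\<lambda>f. \<rho> ^ t * g (\<sigma> s f))"
    using fin Suc inv by (intro expectation_mono_pmf) auto
  also have "\<dots> = \<rho> ^ t * measure_pmf.expectation p (\<lambda>f. g (\<sigma> s f))"
    by simp
  also have "\<dots> \<le> \<rho> ^ t * (\<rho> * g s)"
    using step[OF Suc.prems] \<open>0 \<le> \<rho>\<close> by (intro mult_left_mono) auto
  finally show ?case
    by (simp add: mult_ac)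
qed simp

text \<open>The upper estimate for \<open>- g\<close>, which is available because potentials need
  not be nonnegative. Together the two determine a mean exactly.\<close>

lemma expectation_run_pmf_ge:
  fixes g :: "'s \<Rightarrow> real"
  assumes fin: "finite (set_pmf p)" and "0 \<le> \<rho>"
    and inv: "\<And>s f. I s \<Longrightarrow> f \<in> set_pmf p \<Longrightarrow> I (\<sigma> s f)"
    and step: "\<And>s. I s \<Longrightarrow> \<rho> * g s \<le> measure_pmf.expectation p (\<lambda>f. g (\<sigma> s f))"
    and "I s"
  shows "\<rho> ^ t * g s \<le> measure_pmf.expectation (run_pmf p \<sigma> s t) g"
proof -
  have "measure_pmf.expectation (run_pmf p \<sigma> s t) (\<lambda>s. - g s) \<le> \<rho> ^ t * (- g s)"
    using assms by (intro expectation_run_pmf_le[where I = I]) auto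
  then show ?thesis
    by simp
qed

text \<open>Markov's inequality, with the threshold scaled into \<open>g\<close>.\<close>

lemma prob_le_expectation:
  fixes g :: "'a \<Rightarrow> real"
  assumes "finite (set_pmf p)" "\<And>x. x \<in> set_pmf p \<Longrightarrow> 0 \<le> g x"
    and "\<And>x. x \<in> set_pmf p \<Longrightarrow> x \<in> A \<Longrightarrow> 1 \<le> g x"
  shows "measure_pmf.prob p A \<le> measure_pmf.expectation p g"
proof -
  have "measure_pmf.prob p A = measure_pmf.expectation p (indicator A)"
    by simp
  also have "\<dots> \<le> measure_pmf.expectation p g"
    using assms by (intro expectation_mono_pmf) (auto simp: indicator_def)
  finally show ?thesis .
qed

lemma prob_bind_pmf:
  assumes "finite (set_pmf p)" "\<And>x. x \<in> set_pmf p \<Longrightarrow> finite (set_pmf (q x))"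
  shows "measure_pmf.prob (bind_pmf p q) A = measure_pmf.expectation p (\<lambda>x. measure_pmf.prob (q x) A)"
  using expectation_bind_pmf[OF assms, where h = "indicator A"] by simp

text \<open>Glues two phases: \<open>M\<close> is the set that the first phase should reach, and the
  bound for the second phase must hold from every reachable state in \<open>M\<close>.\<close>

lemma prob_run_pmf_add_le:
  assumes fin: "finite (set_pmf p)"
    and mid: "measure_pmf.prob (run_pmf p \<sigma> s a) (- M) \<le> \<alpha>"
    and late: "\<And>s'. s' \<in> set_pmf (run_pmf p \<sigma> s a) \<Longrightarrow> s' \<in> M \<Longrightarrow>
      measure_pmf.prob (run_pmf p \<sigma> s' b) A \<le> \<beta>"
    and "0 \<le> \<beta>"
  shows "measure_pmf.prob (run_pmf p \<sigma> s (a + b)) A \<le> \<alpha> + \<beta>"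
proof -
  have "measure_pmf.prob (run_pmf p \<sigma> s (a + b)) A
      = measure_pmf.expectation (run_pmf p \<sigma> s a) (\<lambda>s'. measure_pmf.prob (run_pmf p \<sigma> s' b) A)"
    using fin by (simp add: run_pmf_add prob_bind_pmf finite_set_run_pmf)
  also have "\<dots> \<le> measure_pmf.expectation (run_pmf p \<sigma> s a) (\<lambda>s'. indicator (- M) s' + \<beta>)"
  proof (rule expectation_mono_pmf)
    fix s' assume s': "s' \<in> set_pmf (run_pmf p \<sigma> s a)"
    show "measure_pmf.prob (run_pmf p \<sigma> s' b) A \<le> indicator (- M) s' + \<beta>"
      using late[OF s'] \<open>0 \<le> \<beta>\<close>
      by (cases "s' \<in> M") (auto intro: order_trans[OF measure_pmf.prob_le_1])
  qed (simp add: fin finite_set_run_pmf)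
  also have "\<dots> = measure_pmf.prob (run_pmf p \<sigma> s a) (- M) + \<beta>"
    using fin by (subst Bochner_Integration.integral_add)
      (auto intro: integrable_measure_pmf_finite finite_set_run_pmf)
  finally show ?thesis
    using mid by simp
qed

section \<open>From streams of choices to the finite chain\<close>

primrec informed_from :: "nat set \<Rightarrow> (nat \<Rightarrow> nat) stream \<Rightarrow> nat \<Rightarrow> nat set" where
  "informed_from S \<omega> 0 = S"
| "informed_from S \<omega> (Suc t) = informed_from S \<omega> t \<union> (\<omega> !! t) ` informed_from S \<omega> t"

lemma informed_eq_informed_from: "informed v \<omega> t = informed_from {v} \<omega> t"
  by (induction t) auto

text \<open>\<open>informed_from\<close> adds rounds at the end, whereas \<open>run_pmf\<close> and
  the stream measure split them off at the front. Splitting off the first round leaves a start set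
  that need not be a singleton, hence the generalisation of \<open>informed\<close>.\<close>

lemma informed_from_Stream:
  "informed_from S (f ## \<omega>) (Suc t) = informed_from (S \<union> f ` S) \<omega> t"
proof (induction t)
  case (Suc t)
  then show ?case
    by (subst informed_from.simps) (simp only: snth.simps stream.sel informed_from.simps(2))
qed simp

lemma finite_informed_from: "finite S \<Longrightarrow> finite (informed_from S \<omega> t)"
  by (induction t) auto

lemma informed_from_mono: "s \<le> t \<Longrightarrow> informed_from S \<omega> s \<subseteq> informed_from S \<omega> t"
  by (rule lift_Suc_mono_le[of "informed_from S \<omega>"]) auto

text \<open>The informed set is always finite and there are only countably many finite sets of
  naturals. For each possible value \<open>B\<close> at time \<open>t\<close>, the next round
  involves a single coordinate of the stream.\<close>

lemma sets_informed_from: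
  assumes "finite S"
  shows "{\<omega> \<in> space (push_space n E). informed_from S \<omega> t \<in> A} \<in> sets (push_space n E)"
proof (induction t arbitrary: A)
  case 0
  then show ?case
    by (cases "S \<in> A") auto
next
  case (Suc t)
  let ?M = "push_space n E"
  have eq: "{\<omega> \<in> space ?M. informed_from S \<omega> (Suc t) \<in> A} =
    (\<Union>B\<in>{B. finite B}. {\<omega> \<in> space ?M. informed_from S \<omega> t \<in> {B}} \<inter>
      ((\<lambda>\<omega>. \<omega> !! t) -` {f. B \<union> f ` B \<in> A} \<inter> space ?M))"
    using finite_informed_from[OF assms] by auto
  have "(\<lambda>\<omega>. \<omega> !! t) \<in> measurable ?M (measure_pmf (round_choice n E))"
    unfolding push_space_def by simp
  then have meas: "(\<lambda>\<omega>. \<omega> !! t) -` {f. B \<union> f ` B \<in> A} \<inter> space ?M \<in> sets ?M" for B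
    by (rule measurable_sets) simp
  then show ?case
    unfolding eq by (intro sets.countable_UN'' sets.Int Suc.IH meas countable_Collect_finite)
qed

lemma emeasure_informed_from:
  assumes "finite S"
  shows "emeasure (push_space n E) {\<omega> \<in> space (push_space n E). informed_from S \<omega> t \<in> A}
    = emeasure (run_pmf (round_choice n E) (\<lambda>S f. S \<union> f ` S) S t) A"
  using assms
proof (induction t arbitrary: S)
  case 0
  have "prob_space (push_space n E)"
    unfolding push_space_def by (rule prob_space.prob_space_stream_space) (rule measure_pmf.prob_space_axioms)
  then show ?case
    by (cases "S \<in> A") (auto simp: prob_space.emeasure_space_1)
next
  case (Suc t)
  let ?M = "push_space n E"
  have sp: "f ## \<omega> \<in> space ?M \<longleftrightarrow> \<omega> \<in> space ?M" for f \<omega>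
    by (simp add: push_space_def space_stream_space)
  have "emeasure ?M {\<omega> \<in> space ?M. informed_from S \<omega> (Suc t) \<in> A} =
    (\<integral>\<^sup>+f. emeasure ?M {\<omega> \<in> space ?M. f ## \<omega> \<in> {\<omega> \<in> space ?M. informed_from S \<omega> (Suc t) \<in> A}}
      \<partial>measure_pmf (round_choice n E))"
    using sets_informed_from[OF Suc.prems, of n E "Suc t" A] unfolding push_space_def
    by (intro prob_space.emeasure_stream_space measure_pmf.prob_space_axioms)
  also have "\<dots> = (\<integral>\<^sup>+f. emeasure ?M {\<omega> \<in> space ?M. informed_from (S \<union> f ` S) \<omega> t \<in> A}
      \<partial>measure_pmf (round_choice n E))"
    unfolding mem_Collect_eq sp informed_from_Stream by (simp only: conj_assoc[symmetric] conj_absorb)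
  also have "\<dots> = emeasure (run_pmf (round_choice n E) (\<lambda>S f. S \<union> f ` S) S (Suc t)) A"
    using Suc by simp
  finally show ?case .
qed

lemma prob_informed:
  "measure (push_space n E) {\<omega> \<in> space (push_space n E). informed v \<omega> t \<in> A}
    = measure_pmf.prob (run_pmf (round_choice n E) (\<lambda>S f. S \<union> f ` S) {v} t) A"
  using emeasure_informed_from[of "{v}" n E t A]
  by (simp add: informed_eq_informed_from measure_def)

lemma sets_informed:
  "{\<omega> \<in> space (push_space n E). informed v \<omega> t \<in> A} \<in> sets (push_space n E)"
  unfolding informed_eq_informed_from by (rule sets_informed_from) simp

section \<open>Spreading time in terms of the informed sets\<close>

lemma push_time_eq_enat_iff:
  "push_time n v \<omega> = enat m \<longleftrightarrow>
    informed v \<omega> m = {0..<n} \<and> (\<forall>j<m. informed v \<omega> j \<noteq> {0..<n})" (is "?l \<longleftrightarrow> ?r")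
proof
  assume l: ?l
  then have ex: "\<exists>t. informed v \<omega> t = {0..<n}" and m: "m = (LEAST t. informed v \<omega> t = {0..<n})"
    by (auto simp: push_time_def split: if_splits)
  show ?r
    using LeastI_ex[OF ex] not_less_Least[of _ "\<lambda>t. informed v \<omega> t = {0..<n}"] by (auto simp: m)
next
  assume ?r
  then have "(LEAST t. informed v \<omega> t = {0..<n}) = m"
    by (intro Least_equality) (auto simp: not_less[symmetric])
  with \<open>?r\<close> show ?l
    by (auto simp: push_time_def)
qed

text \<open>Choices outside the vertex set have probability 0 but occur in the sample space, hence the
  inclusion instead of an equation in the lower bound.\<close>
lemma push_time_bounds:
  assumes upper: "informed v \<omega> b = {0..<n}" and lower: "\<not> {0..<n} \<subseteq> informed v \<omega> a"
  obtains m where "push_time n v \<omega> = enat m" "a < m" "m \<le> b"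
proof -
  define m where "m = (LEAST t. informed v \<omega> t = {0..<n})"
  have m: "push_time n v \<omega> = enat m"
    using upper by (auto simp: push_time_def m_def)
  then have m': "informed v \<omega> m = {0..<n}"
    by (simp add: push_time_eq_enat_iff)
  have "m \<le> b"
    unfolding m_def using upper by (rule Least_le)
  moreover have "a < m"
  proof (rule ccontr)
    assume "\<not> a < m"
    then have "informed v \<omega> m \<subseteq> informed v \<omega> a"
      unfolding informed_eq_informed_from by (intro informed_from_mono) simp
    with m' lower show False by simp
  qed
  ultimately show thesis
    using m that by blast
qed

lemma sets_push_time:
  "{\<omega> \<in> space (push_space n E). push_time n v \<omega> \<noteq> \<infinity> \<and> P (the_enat (push_time n v \<omega>))}
    \<in> sets (push_space n E)"
proof -
  let ?M = "push_space n E"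
  have "{\<omega> \<in> space ?M. push_time n v \<omega> \<noteq> \<infinity> \<and> P (the_enat (push_time n v \<omega>))} =
    (\<Union>m\<in>{m. P m}. {\<omega> \<in> space ?M. informed v \<omega> m \<in> {{0..<n}}} \<inter>
      (space ?M - (\<Union>j\<in>{..<m}. {\<omega> \<in> space ?M. informed v \<omega> j \<in> {{0..<n}}})))"
    (is "?L = ?R")
  proof -
    have "?L = {\<omega> \<in> space ?M. \<exists>m. P m \<and> push_time n v \<omega> = enat m}"
      by (auto simp: not_infinity_eq)
    also have "\<dots> = ?R"
      unfolding push_time_eq_enat_iff by auto
    finally show ?thesis .
  qed
  also have "\<dots> \<in> sets ?M"
    by (intro sets.countable_UN'' sets.Int sets.Diff sets.top sets.finite_UN sets_informed) simp_all
  finally show ?thesis .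
qed

text \<open>A union bound: if all vertices are informed at time \<open>b\<close> but not at time
  \<open>a\<close>, the spreading time lies in the interval from \<open>a + 1\<close> to
  \<open>b\<close>. This leaves two tail estimates for the finite chain.\<close>

lemma prob_push_time_ge:
  assumes "\<And>m. a < m \<Longrightarrow> m \<le> b \<Longrightarrow> P m"
  shows "measure (push_space n E)
      {\<omega> \<in> space (push_space n E). push_time n v \<omega> \<noteq> \<infinity> \<and> P (the_enat (push_time n v \<omega>))}
    \<ge> 1 - measure_pmf.prob (run_pmf (round_choice n E) (\<lambda>S f. S \<union> f ` S) {v} b) (- {{0..<n}})
        - measure_pmf.prob (run_pmf (round_choice n E) (\<lambda>S f. S \<union> f ` S) {v} a) {S. {0..<n} \<subseteq> S}"
proof -
  let ?M = "push_space n E"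
  interpret prob_space ?M
    unfolding push_space_def by (rule prob_space.prob_space_stream_space) (rule measure_pmf.prob_space_axioms)
  let ?X = "{\<omega> \<in> space ?M. push_time n v \<omega> \<noteq> \<infinity> \<and> P (the_enat (push_time n v \<omega>))}"
  let ?U = "{\<omega> \<in> space ?M. informed v \<omega> b \<in> - {{0..<n}}}"
  let ?L = "{\<omega> \<in> space ?M. informed v \<omega> a \<in> {S. {0..<n} \<subseteq> S}}"
  have "space ?M \<subseteq> ?X \<union> (?U \<union> ?L)"
  proof
    fix \<omega> assume \<omega>: "\<omega> \<in> space ?M"
    show "\<omega> \<in> ?X \<union> (?U \<union> ?L)"
    proof (cases "\<omega> \<in> ?U \<union> ?L")
      case False
      with \<omega> have "informed v \<omega> b = {0..<n}" "\<not> {0..<n} \<subseteq> informed v \<omega> a"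
        by auto
      then obtain m where "push_time n v \<omega> = enat m" "a < m" "m \<le> b"
        by (rule push_time_bounds)
      with \<omega> assms show ?thesis by auto
    qed simp
  qed
  then have "prob (space ?M) \<le> prob (?X \<union> (?U \<union> ?L))"
    by (rule finite_measure_mono) (intro sets.Un sets_informed sets_push_time)
  also have "\<dots> \<le> prob ?X + (prob ?U + prob ?L)"
    by (intro order_trans[OF measure_Un_le] add_left_mono
        measure_Un_le sets.Un sets_informed sets_push_time order_refl)
  finally show ?thesis
    unfolding prob_informed prob_space by simp
qed

section \<open>One round on an expander\<close>

lemma sum_of_bool_card: "finite A \<Longrightarrow> (\<Sum>x\<in>A. of_bool (P x) :: real) = card {x\<in>A. P x}"
  by (simp add: of_bool_def sum.If_cases Int_def)

lemma exp_minus_le_quadratic: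
  fixes y :: real
  assumes "0 \<le> y"
  shows "exp (- y) \<le> 1 - y + y\<^sup>2 / 2"
proof -
  \<comment> \<open>The product equals 1 + y^4 / 4, so the claimed bound is at least the inverse of
    the Taylor bound for \<open>exp y\<close>.\<close>
  have "1 \<le> (1 - y + y\<^sup>2 / 2) * (1 + y + y\<^sup>2 / 2)"
    using assms by (simp add: power2_eq_square algebra_simps)
  also have "\<dots> \<le> (1 - y + y\<^sup>2 / 2) * exp y"
  proof (intro mult_left_mono exp_lower_Taylor_quadratic assms)
    have "0 \<le> (1 - y)\<^sup>2"
      by simp
    then show "0 \<le> 1 - y + y\<^sup>2 / 2"
      by (simp add: power2_eq_square algebra_simps)
  qed
  finally show ?thesis
    by (simp add: exp_minus field_simps)
qed

section \<open>Hitting probabilities on a regular graph\<close>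

locale regular_graph =
  fixes n :: nat and E :: "nat \<Rightarrow> nat \<Rightarrow> bool" and d :: nat
  assumes simple: "simple_graph n E" and regular: "regular n E d" and d_pos: "d > 0"
begin

lemma edge_sym: "E i j \<longleftrightarrow> E j i"
  using simple by (auto simp: simple_graph_def)

lemma nbrs_subset: "nbrs E u \<subseteq> {0..<n}"
  using simple by (auto simp: simple_graph_def nbrs_def)

lemma finite_nbrs: "finite (nbrs E u)"
  using nbrs_subset finite_subset by blast

lemma card_nbrs: "u < n \<Longrightarrow> card (nbrs E u) = d"
  using regular by (simp add: regular_def)

lemma nbrs_nonempty: "u < n \<Longrightarrow> nbrs E u \<noteq> {}"
  using card_nbrs[of u] d_pos by auto

lemma set_round_choice: "set_pmf (round_choice n E) = PiE_dflt {0..<n} 0 (nbrs E)"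
  unfolding round_choice_def
  by (subst set_Pi_pmf) (auto simp: PiE_dflt_def nbrs_nonempty finite_nbrs)

lemma finite_set_round_choice: "finite (set_pmf (round_choice n E))"
  unfolding set_round_choice by (intro finite_PiE_dflt finite_nbrs) simp

lemma choice_image_subset:
  "f \<in> set_pmf (round_choice n E) \<Longrightarrow> S \<subseteq> {0..<n} \<Longrightarrow> f ` S \<subseteq> {0..<n}"
  using nbrs_subset by (fastforce simp: set_round_choice PiE_dflt_def)

text \<open>Independence of the choices. Taking \<open>B\<close> to be one vertex gives the chance
  that it is missed; two vertices give the pair correlations of the lower bound.\<close>

lemma prob_all_avoid:
  assumes S: "S \<subseteq> {0..<n}"
  shows "measure_pmf.prob (round_choice n E) {f. \<forall>w\<in>S. f w \<notin> B}
    = (\<Prod>w\<in>S. 1 - real (card (nbrs E w \<inter> B)) / real d)"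
proof -
  have "{f. \<forall>w\<in>S. f w \<notin> B} = Pi {0..<n} (\<lambda>w. if w \<in> S then - B else UNIV)"
    using S by (auto simp: Pi_def)
  then have "measure_pmf.prob (round_choice n E) {f. \<forall>w\<in>S. f w \<notin> B} =
      (\<Prod>w\<in>{0..<n}. measure_pmf.prob (pmf_of_set (nbrs E w)) (if w \<in> S then - B else UNIV))"
    by (simp add: round_choice_def measure_Pi_pmf_Pi)
  also have "\<dots> = (\<Prod>w\<in>S. measure_pmf.prob (pmf_of_set (nbrs E w)) (- B))"
    using S by (intro prod.mono_neutral_cong_right) auto
  also have "\<dots> = (\<Prod>w\<in>S. 1 - real (card (nbrs E w \<inter> B)) / real d)"
  proof (intro prod.cong refl)
    fix w assume "w \<in> S"
    then have w: "w < n" using S by auto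
    have "card (nbrs E w \<inter> - B) = d - card (nbrs E w \<inter> B)"
      using card_nbrs[OF w] by (simp add: card_Diff_subset_Int finite_nbrs Diff_eq[symmetric])
    moreover have "card (nbrs E w \<inter> B) \<le> d"
      using card_mono[OF finite_nbrs, of "nbrs E w \<inter> B" w] card_nbrs[OF w] by simp
    ultimately show "measure_pmf.prob (pmf_of_set (nbrs E w)) (- B)
        = 1 - real (card (nbrs E w \<inter> B)) / real d"
      using d_pos w
      by (simp add: measure_pmf_of_set nbrs_nonempty finite_nbrs card_nbrs of_nat_diff diff_divide_distrib)
  qed
  finally show ?thesis .
qed

lemma prob_not_hit:
  assumes S: "S \<subseteq> {0..<n}"
  shows "measure_pmf.prob (round_choice n E) {f. u \<notin> f ` S}
    = (1 - 1 / real d) ^ card (nbrs E u \<inter> S)"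
proof -
  have fin: "finite S"
    using S finite_subset by blast
  have "{f. u \<notin> f ` S} = {f. \<forall>w\<in>S. f w \<notin> {u}}"
    by auto
  then have "measure_pmf.prob (round_choice n E) {f. u \<notin> f ` S}
      = (\<Prod>w\<in>S. 1 - real (card (nbrs E w \<inter> {u})) / real d)"
    by (simp only: prob_all_avoid[OF S])
  also have "\<dots> = (\<Prod>w\<in>S. if w \<in> nbrs E u then 1 - 1 / real d else 1)"
    by (intro prod.cong refl) (auto simp: nbrs_def edge_sym)
  also have "\<dots> = (1 - 1 / real d) ^ card (nbrs E u \<inter> S)"
    using fin by (simp add: prod.If_cases Int_commute)
  finally show ?thesis .
qed

lemma expectation_card_unhit:
  assumes S: "S \<subseteq> {0..<n}" and U: "finite U"
  shows "measure_pmf.expectation (round_choice n E) (\<lambda>f. real (card (U - f ` S)))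
    = (\<Sum>u\<in>U. (1 - 1 / real d) ^ card (nbrs E u \<inter> S))"
proof -
  have "real (card (U - f ` S)) = (\<Sum>u\<in>U. indicator {f. u \<notin> f ` S} f)" for f
  proof -
    have "U - f ` S = {u\<in>U. u \<notin> f ` S}"
      by auto
    then show ?thesis
      using U by (simp add: sum_of_bool_card[symmetric] indicator_def of_bool_def)
  qed
  then have "measure_pmf.expectation (round_choice n E) (\<lambda>f. real (card (U - f ` S)))
    = (\<Sum>u\<in>U. measure_pmf.expectation (round_choice n E) (indicator {f. u \<notin> f ` S}))"
    by (simp add: integrable_measure_pmf_finite[OF finite_set_round_choice])
  then show ?thesis
    using prob_not_hit[OF S] by simp
qed

text \<open>By symmetry and regularity this is also the expected number of transmissions that
  \<open>u\<close> receives in a round in which exactly the vertices of \<open>S\<close>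
  push.\<close>

definition nfrac :: "nat \<Rightarrow> nat set \<Rightarrow> real" where
  "nfrac u S = real (card (nbrs E u \<inter> S)) / real d"

lemma nfrac_nonneg: "0 \<le> nfrac u S"
  by (simp add: nfrac_def)

lemma nfrac_Diff:
  assumes "u < n" "S \<subseteq> {0..<n}"
  shows "nfrac u ({0..<n} - S) = 1 - nfrac u S"
proof -
  have "nbrs E u \<inter> ({0..<n} - S) = nbrs E u - nbrs E u \<inter> S"
    using nbrs_subset by auto
  then have "card (nbrs E u \<inter> ({0..<n} - S)) = d - card (nbrs E u \<inter> S)"
    using assms by (simp add: card_Diff_subset finite_nbrs card_nbrs)
  moreover have "card (nbrs E u \<inter> S) \<le> d"
    using card_mono[OF finite_nbrs, of "nbrs E u \<inter> S" u] card_nbrs assms by simp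
  ultimately show ?thesis
    using d_pos by (simp add: nfrac_def of_nat_diff diff_divide_distrib)
qed

text \<open>Double counting of edges: every vertex of \<open>S\<close> sends out one
  transmission.\<close>

lemma sum_nfrac:
  assumes "S \<subseteq> {0..<n}"
  shows "(\<Sum>u<n. nfrac u S) = real (card S)"
proof -
  have fin: "finite S"
    using assms finite_subset by blast
  have "(\<Sum>u<n. real (card (nbrs E u \<inter> S))) = (\<Sum>u<n. \<Sum>w\<in>S. of_bool (E u w))"
  proof (intro sum.cong refl)
    fix u
    have "nbrs E u \<inter> S = {w\<in>S. E u w}"
      by (auto simp: nbrs_def)
    then show "real (card (nbrs E u \<inter> S)) = (\<Sum>w\<in>S. of_bool (E u w))"
      by (simp only: sum_of_bool_card[OF fin])
  qed
  also have "\<dots> = (\<Sum>w\<in>S. \<Sum>u<n. of_bool (E u w))"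
    by (rule sum.swap)
  also have "\<dots> = (\<Sum>w\<in>S. real d)"
  proof (intro sum.cong refl)
    fix w assume "w \<in> S"
    then have "{u \<in> {..<n}. E u w} = nbrs E w" "w < n"
      using nbrs_subset[of w] assms by (auto simp: nbrs_def edge_sym[of _ w])
    then show "(\<Sum>u<n. of_bool (E u w)) = real d"
      by (simp only: sum_of_bool_card[OF finite_lessThan] card_nbrs)
  qed
  finally show ?thesis
    using d_pos by (simp add: nfrac_def flip: sum_divide_distrib)
qed

lemma expectation_uninformed_le:
  assumes S: "S \<subseteq> {0..<n}"
  shows "measure_pmf.expectation (round_choice n E) (\<lambda>f. real (card ({0..<n} - (S \<union> f ` S))))
    \<le> (\<Sum>u\<in>{0..<n} - S. exp (- nfrac u S))"
proof -
  have "measure_pmf.expectation (round_choice n E) (\<lambda>f. real (card ({0..<n} - (S \<union> f ` S))))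
    = (\<Sum>u\<in>{0..<n} - S. (1 - 1 / real d) ^ card (nbrs E u \<inter> S))"
    using expectation_card_unhit[OF S, of "{0..<n} - S"] by (simp add: Diff_eq Int_assoc)
  also have "\<dots> \<le> (\<Sum>u\<in>{0..<n} - S. exp (- nfrac u S))"
  proof (rule sum_mono)
    fix u
    have "(1 - 1 / real d) ^ card (nbrs E u \<inter> S) \<le> exp (- 1 / real d) ^ card (nbrs E u \<inter> S)"
      using d_pos exp_ge_add_one_self[of "- 1 / real d"] by (intro power_mono) auto
    also have "\<dots> = exp (- nfrac u S)"
      by (simp add: nfrac_def flip: exp_of_nat_mult)
    finally show "(1 - 1 / real d) ^ card (nbrs E u \<inter> S) \<le> exp (- nfrac u S)" .
  qed
  finally show ?thesis .
qed

end

text \<open>The parameter \<open>\<eta>\<close> plays the role of \<open>\<lambda> / d\<close>.\<close>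
locale expander = regular_graph +
  fixes \<eta> :: real
  assumes \<eta>_nonneg: "0 \<le> \<eta>"
    and variance: "\<And>S. S \<subseteq> {0..<n} \<Longrightarrow>
      (\<Sum>u<n. (nfrac u S - real (card S) / real n)\<^sup>2) \<le> \<eta>\<^sup>2 * real (card S)"
begin

text \<open>The second moment is the squared mean plus the variance. It measures the transmissions
  lost because several reach the same vertex.\<close>

lemma sum_nfrac_square_le:
  assumes "S \<subseteq> {0..<n}"
  shows "(\<Sum>u<n. (nfrac u S)\<^sup>2) \<le> (real (card S))\<^sup>2 / real n + \<eta>\<^sup>2 * real (card S)"
proof (cases "n = 0")
  case False
  let ?m = "real (card S) / real n"
  have "(\<Sum>u<n. (nfrac u S - ?m)\<^sup>2) = (\<Sum>u<n. (nfrac u S)\<^sup>2) - 2 * ?m * (\<Sum>u<n. nfrac u S) + real n * ?m\<^sup>2"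
    by (simp add: power2_diff sum.distrib sum_subtractf sum_distrib_left sum_divide_distrib mult_ac)
  also have "\<dots> = (\<Sum>u<n. (nfrac u S)\<^sup>2) - (real (card S))\<^sup>2 / real n"
    using False unfolding sum_nfrac[OF assms] by (simp add: power2_eq_square field_simps)
  finally show ?thesis
    using variance[OF assms] by simp
qed (use assms in simp)

text \<open>The expander mixing bound for the pair (S, S): Cauchy-Schwarz of the deviations against
  the indicator of \<open>S\<close>. It measures the transmissions lost on informed
  vertices.\<close>

lemma sum_nfrac_inside_le:
  assumes S: "S \<subseteq> {0..<n}"
  shows "(\<Sum>u\<in>S. nfrac u S) \<le> (real (card S))\<^sup>2 / real n + \<eta> * real (card S)"
proof -
  let ?m = "real (card S) / real n"
  have fin: "finite S" and S': "S \<subseteq> {..<n}"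
    using S finite_subset by auto
  have "(\<Sum>u\<in>S. (nfrac u S - ?m) * 1) \<le> sqrt (\<Sum>u\<in>S. (nfrac u S - ?m)\<^sup>2) * sqrt (\<Sum>u\<in>S. 1\<^sup>2)"
    using L2_set_mult_ineq[of "\<lambda>u. nfrac u S - ?m" "\<lambda>_. 1" S] unfolding L2_set_def
    by (rule order_trans[rotated]) (intro sum_mono, simp)
  also have "\<dots> \<le> sqrt (\<eta>\<^sup>2 * real (card S)) * sqrt (real (card S))"
    using variance[OF S] sum_mono2[OF finite_lessThan S', of "\<lambda>u. (nfrac u S - ?m)\<^sup>2"]
    by (intro mult_mono) auto
  also have "\<dots> = \<eta> * real (card S)"
    using \<eta>_nonneg by (simp add: real_sqrt_mult mult.assoc)
  finally show ?thesis
    by (simp add: sum_subtractf power2_eq_square)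
qed

text \<open>Of the s transmissions, at most s^2 / n + \<eta> s, hence 2 \<delta> s, land inside
  \<open>S\<close>. The quadratic term of the exponential costs another (s^2 / n + \<eta>^2 s) / 2,
  at most \<delta> s. This gives the constant 3.\<close>

lemma growth_lower_bound:
  assumes S: "S \<subseteq> {0..<n}" and small: "real (card S) \<le> \<delta> * real n" and "\<eta> \<le> \<delta>" "\<delta> \<le> 1"
  shows "(1 - 3 * \<delta>) * real (card S) \<le>
    real (card ({0..<n} - S))
      - measure_pmf.expectation (round_choice n E) (\<lambda>f. real (card ({0..<n} - (S \<union> f ` S))))"
proof -
  let ?s = "real (card S)" and ?y = "\<lambda>u. nfrac u S"
  have S': "{..<n} - ({0..<n} - S) = S" "{0..<n} - S \<subseteq> {..<n}" "S \<subseteq> {..<n}"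
    using S by auto
  have "(\<Sum>u\<in>{0..<n} - S. exp (- ?y u)) \<le> (\<Sum>u\<in>{0..<n} - S. 1 - ?y u + (?y u)\<^sup>2 / 2)"
    by (intro sum_mono exp_minus_le_quadratic nfrac_nonneg)
  also have "\<dots> = real (card ({0..<n} - S)) - (\<Sum>u\<in>{0..<n} - S. ?y u) + (\<Sum>u\<in>{0..<n} - S. (?y u)\<^sup>2) / 2"
    by (simp add: sum.distrib sum_subtractf sum_divide_distrib)
  also have "(\<Sum>u\<in>{0..<n} - S. ?y u) = ?s - (\<Sum>u\<in>S. ?y u)"
    using sum.subset_diff[OF S'(3), of ?y] sum_nfrac[OF S] by (simp add: atLeast0LessThan)
  also have "(\<Sum>u\<in>{0..<n} - S. (?y u)\<^sup>2) \<le> (\<Sum>u<n. (?y u)\<^sup>2)"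
    by (intro sum_mono2 S') auto
  finally have "measure_pmf.expectation (round_choice n E) (\<lambda>f. real (card ({0..<n} - (S \<union> f ` S))))
     \<le> real (card ({0..<n} - S)) - (?s - (\<Sum>u\<in>S. ?y u)) + (\<Sum>u<n. (?y u)\<^sup>2) / 2"
    using expectation_uninformed_le[OF S] by simp
  moreover have sq: "?s\<^sup>2 / real n \<le> \<delta> * ?s"
  proof (cases "n = 0")
    case False
    then have "?s * ?s \<le> (\<delta> * real n) * ?s"
      using small by (intro mult_right_mono) auto
    with False show ?thesis
      by (simp add: power2_eq_square field_simps)
  qed (use small in simp)
  moreover have "\<eta> * ?s \<le> \<delta> * ?s"
    using assms by (intro mult_right_mono) auto
  moreover have "\<eta>\<^sup>2 * ?s \<le> \<delta> * ?s"
  proof -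
    have "\<eta> * \<eta> \<le> \<delta> * 1"
      using assms \<eta>_nonneg by (intro mult_mono) auto
    then show ?thesis
      by (intro mult_right_mono) (simp_all add: power2_eq_square)
  qed
  ultimately show ?thesis
    using sum_nfrac_inside_le[OF S] sum_nfrac_square_le[OF S] by (simp add: algebra_simps)
qed

text \<open>On [s, 2s] the function 1/x lies below its chord, which is affine in the growth, so the
  expected growth suffices. A growth of (1 - 3 \<delta>) s yields the factor 1 - (1 - 3 \<delta>) /
  2.\<close>

lemma expectation_inverse_card_le:
  assumes S: "S \<subseteq> {0..<n}" "S \<noteq> {}" and small: "real (card S) \<le> \<delta> * real n"
    and "\<eta> \<le> \<delta>" "\<delta> \<le> 1"
  shows "measure_pmf.expectation (round_choice n E) (\<lambda>f. 1 / real (card (S \<union> f ` S)))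
    \<le> (1/2 + 3 * \<delta> / 2) * (1 / real (card S))"
proof -
  let ?p = "round_choice n E" and ?s = "real (card S)"
  let ?X = "\<lambda>f. real (card ({0..<n} - S)) - real (card ({0..<n} - (S \<union> f ` S)))"
  have fin: "finite S"
    using S finite_subset by blast
  then have s: "?s > 0"
    using S by (simp add: card_gt_0_iff)
  note intg = integrable_measure_pmf_finite[OF finite_set_round_choice]
  have "1 / real (card (S \<union> f ` S)) \<le> (1 / ?s) * (1 - ?X f / (2 * ?s))"
    if f: "f \<in> set_pmf ?p" for f
  proof -
    have sub: "S \<union> f ` S \<subseteq> {0..<n}"
      using choice_image_subset[OF f S(1)] S by auto
    have X: "?X f = real (card (S \<union> f ` S)) - ?s"
      using sub S fin card_mono[OF _ sub] card_mono[OF _ S(1)]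
      by (simp add: card_Diff_subset of_nat_diff finite_subset)
    have "?s \<le> real (card (S \<union> f ` S))"
      using fin by (simp add: card_mono)
    moreover have "card (S \<union> f ` S) \<le> card S + card S"
      using card_Un_le[of S "f ` S"] card_image_le[OF fin, of f] by simp
    then have "real (card (S \<union> f ` S)) \<le> 2 * ?s"
      by linarith
    \<comment> \<open>This product inequality is the chord bound with denominators cleared.\<close>
    ultimately have "0 \<le> (real (card (S \<union> f ` S)) - ?s) * (2 * ?s - real (card (S \<union> f ` S)))"
      by (intro mult_nonneg_nonneg) auto
    then show ?thesis
      unfolding X using s \<open>?s \<le> real (card (S \<union> f ` S))\<close>
      by (simp add: field_simps)
  qed
  then have "measure_pmf.expectation ?p (\<lambda>f. 1 / real (card (S \<union> f ` S)))
      \<le> measure_pmf.expectation ?p (\<lambda>f. (1 / ?s) * (1 - ?X f / (2 * ?s)))"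
    by (intro expectation_mono_pmf finite_set_round_choice)
  also have "\<dots> = (1 / ?s) * (1 - (real (card ({0..<n} - S))
      - measure_pmf.expectation ?p (\<lambda>f. real (card ({0..<n} - (S \<union> f ` S))))) / (2 * ?s))"
    by (simp add: intg)
  also have "\<dots> \<le> (1 / ?s) * (1 - ((1 - 3 * \<delta>) * ?s) / (2 * ?s))"
    using growth_lower_bound[OF S(1) small assms(4,5)] s
    by (intro mult_left_mono diff_left_mono divide_right_mono) auto
  also have "\<dots> = (1/2 + 3 * \<delta> / 2) * (1 / ?s)"
    using s by (simp add: field_simps)
  finally show ?thesis .
qed

text \<open>A vertex whose \<open>nfrac\<close> is at least half the mean s / n stays uninformed
  with probability at most exp (- \<delta> / 2). The others deviate from the mean by more than s /
  (2 n), so the variance bound limits their number as in Chebyshev's inequality.\<close>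

lemma expectation_uninformed_middle:
  assumes S: "S \<subseteq> {0..<n}" and large: "\<delta> * real n \<le> real (card S)" and "0 < \<delta>" "n > 0"
  shows "measure_pmf.expectation (round_choice n E) (\<lambda>f. real (card ({0..<n} - (S \<union> f ` S))))
    \<le> exp (- \<delta> / 2) * real (card ({0..<n} - S)) + 4 * \<eta>\<^sup>2 / \<delta> * real n"
proof -
  let ?s = "real (card S)" and ?y = "\<lambda>u. nfrac u S"
  have s: "?s > 0"
    using large mult_pos_pos[of \<delta> "real n"] assms by linarith
  \<comment> \<open>The second summand is at least 1 at every atypical vertex; charging it
    everywhere avoids splitting the sum.\<close>
  have "exp (- ?y u) \<le> exp (- \<delta> / 2) + (?y u - ?s / n)\<^sup>2 * (2 * n / ?s)\<^sup>2" for u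
  proof (cases "?y u \<ge> ?s / (2 * n)")
    case True
    have "\<delta> \<le> ?s / n"
      using large \<open>n > 0\<close> by (simp add: field_simps)
    then have "exp (- ?y u) \<le> exp (- \<delta> / 2)"
      using True by (simp add: field_simps)
    moreover have "0 \<le> (?y u - ?s / n)\<^sup>2 * (2 * n / ?s)\<^sup>2"
      by simp
    ultimately show ?thesis by linarith
  next
    case False
    then have "?s / (2 * n) \<le> ?s / n - ?y u"
      using s \<open>n > 0\<close> by (simp add: field_simps)
    then have "(?s / (2 * n)) * (2 * n / ?s) \<le> (?s / n - ?y u) * (2 * n / ?s)"
      by (intro mult_right_mono) auto
    then have "1 \<le> (?s / n - ?y u) * (2 * n / ?s)"
      using s \<open>n > 0\<close> by simp
    then have "1\<^sup>2 \<le> ((?s / n - ?y u) * (2 * n / ?s))\<^sup>2"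
      by (intro power_mono) auto
    then have "1 \<le> (?y u - ?s / n)\<^sup>2 * (2 * n / ?s)\<^sup>2"
      unfolding power_mult_distrib by (simp add: power2_commute)
    moreover have "exp (- ?y u) \<le> 1" "0 \<le> exp (- \<delta> / 2)"
      by (simp_all add: nfrac_nonneg)
    ultimately show ?thesis by linarith
  qed
  then have "(\<Sum>u\<in>{0..<n} - S. exp (- ?y u))
    \<le> (\<Sum>u\<in>{0..<n} - S. exp (- \<delta> / 2) + (?y u - ?s / n)\<^sup>2 * (2 * n / ?s)\<^sup>2)"
    by (intro sum_mono)
  also have "\<dots> = exp (- \<delta> / 2) * real (card ({0..<n} - S))
      + (\<Sum>u\<in>{0..<n} - S. (?y u - ?s / n)\<^sup>2) * (2 * n / ?s)\<^sup>2"
    by (simp add: sum.distrib sum_distrib_right)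
  also have "\<dots> \<le> exp (- \<delta> / 2) * real (card ({0..<n} - S)) + \<eta>\<^sup>2 * ?s * (2 * n / ?s)\<^sup>2"
    by (intro add_left_mono mult_right_mono order_trans[OF sum_mono2 variance[OF S]]) auto
  also have "\<eta>\<^sup>2 * ?s * (2 * n / ?s)\<^sup>2 = 4 * \<eta>\<^sup>2 * real n * (n / ?s)"
    using s by (simp add: power2_eq_square field_simps)
  also have "exp (- \<delta> / 2) * real (card ({0..<n} - S)) + 4 * \<eta>\<^sup>2 * real n * (n / ?s)
      \<le> exp (- \<delta> / 2) * real (card ({0..<n} - S)) + 4 * \<eta>\<^sup>2 * real n * (1 / \<delta>)"
    using large s \<open>0 < \<delta>\<close> by (intro add_left_mono mult_left_mono) (simp_all add: field_simps)
  finally show ?thesis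
    using expectation_uninformed_le[OF S] by simp
qed

text \<open>The variance bound is used for the complement of \<open>S\<close>, not for
  \<open>S\<close>: its error is then proportional to the number of uninformed vertices and the
  contraction persists down to the last of them. A vertex with more than a fraction 2 \<delta> of
  uninformed neighbours deviates by at least \<delta>, as the mean is at most \<delta>.\<close>

lemma expectation_uninformed_late:
  assumes S: "S \<subseteq> {0..<n}" and large: "real (card ({0..<n} - S)) \<le> \<delta> * real n" and "0 < \<delta>" "n > 0"
  shows "measure_pmf.expectation (round_choice n E) (\<lambda>f. real (card ({0..<n} - (S \<union> f ` S))))
    \<le> (exp (- (1 - 2 * \<delta>)) + \<eta>\<^sup>2 / \<delta>\<^sup>2) * real (card ({0..<n} - S))"
proof -
  let ?T = "{0..<n} - S"
  let ?x = "real (card ?T)" and ?z = "\<lambda>u. nfrac u ?T"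
  have "exp (- nfrac u S) \<le> exp (- (1 - 2 * \<delta>)) + (?z u - ?x / n)\<^sup>2 / \<delta>\<^sup>2" if "u \<in> ?T" for u
  proof (cases "?z u \<le> 2 * \<delta>")
    case True
    then have "exp (- nfrac u S) \<le> exp (- (1 - 2 * \<delta>))"
      using nfrac_Diff[OF _ S, of u] that by simp
    moreover have "0 \<le> (?z u - ?x / n)\<^sup>2 / \<delta>\<^sup>2"
      by simp
    ultimately show ?thesis by linarith
  next
    case False
    have "?x / n \<le> \<delta>"
      using large \<open>n > 0\<close> by (simp add: field_simps)
    with False have "\<delta>\<^sup>2 \<le> (?z u - ?x / n)\<^sup>2"
      using \<open>0 < \<delta>\<close> by (intro power_mono) auto
    then have "1 \<le> (?z u - ?x / n)\<^sup>2 / \<delta>\<^sup>2"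
      using \<open>0 < \<delta>\<close> by simp
    moreover have "exp (- nfrac u S) \<le> 1" "0 \<le> exp (- (1 - 2 * \<delta>))"
      by (simp_all add: nfrac_nonneg)
    ultimately show ?thesis by linarith
  qed
  then have "(\<Sum>u\<in>?T. exp (- nfrac u S)) \<le> (\<Sum>u\<in>?T. exp (- (1 - 2 * \<delta>)) + (?z u - ?x / n)\<^sup>2 / \<delta>\<^sup>2)"
    by (intro sum_mono)
  also have "\<dots> = exp (- (1 - 2 * \<delta>)) * ?x + (\<Sum>u\<in>?T. (?z u - ?x / n)\<^sup>2) / \<delta>\<^sup>2"
    by (simp add: sum.distrib sum_divide_distrib)
  also have "(\<Sum>u\<in>?T. (?z u - ?x / n)\<^sup>2) \<le> (\<Sum>u<n. (?z u - ?x / n)\<^sup>2)"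
    by (intro sum_mono2) auto
  also have "\<dots> \<le> \<eta>\<^sup>2 * ?x"
    by (rule variance) auto
  finally show ?thesis
    using expectation_uninformed_le[OF S] by (simp add: divide_right_mono field_simps)
qed

end

section \<open>The phases of the process\<close>

context expander
begin

abbreviation push_run :: "nat set \<Rightarrow> nat \<Rightarrow> nat set pmf" where
  "push_run \<equiv> run_pmf (round_choice n E) (\<lambda>S f. S \<union> f ` S)"

lemma finite_set_push_run: "finite (set_pmf (push_run S t))"
  by (intro finite_set_run_pmf finite_set_round_choice)

lemma push_run_superset:
  assumes "S' \<in> set_pmf (push_run S t)" "S \<subseteq> {0..<n}"
  shows "S \<subseteq> S'" "S' \<subseteq> {0..<n}"
proof -
  have "S \<subseteq> S' \<and> S' \<subseteq> {0..<n}"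
    by (rule run_pmf_invariant[OF _ _ assms(1)]) (use assms(2) choice_image_subset in auto)
  then show "S \<subseteq> S'" "S' \<subseteq> {0..<n}" by auto
qed

text \<open>The potential of the growth phase is the inverse of the number of informed vertices. A round
  at most doubles that number, so by convexity its expected growth already controls the
  expectation of the potential and no concentration is needed.\<close>
lemma early_phase:
  assumes S: "S \<subseteq> {0..<n}" "S \<noteq> {}" and "\<eta> \<le> \<delta>" "0 < \<delta>" "\<delta> \<le> 1"
  shows "measure_pmf.prob (push_run S t) {S. real (card S) < \<delta> * real n}
    \<le> \<delta> * real n * (1/2 + 3 * \<delta> / 2) ^ t"
proof -
  \<comment> \<open>Cutting off at the threshold makes the contraction trivial afterwards, since
    informed sets only grow and the potential stays 0.\<close>
  let ?g = "\<lambda>S. if real (card S) < \<delta> * real n then 1 / real (card S) else 0 :: real"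
  have n: "n > 0"
    using S by auto
  let ?I = "\<lambda>S. S \<noteq> {} \<and> S \<subseteq> {0..<n}"
  have inv: "?I (S \<union> f ` S)" if "?I S" "f \<in> set_pmf (round_choice n E)" for S f
    using that choice_image_subset by auto
  have I: "card S \<ge> 1" if "?I S" for S
    using that finite_subset[of S "{0..<n}"] by (simp add: Suc_le_eq card_gt_0_iff)
  have step: "measure_pmf.expectation (round_choice n E) (\<lambda>f. ?g (S \<union> f ` S)) \<le> (1/2 + 3 * \<delta> / 2) * ?g S"
    if S: "?I S" for S
  proof (cases "real (card S) < \<delta> * real n")
    case True
    have "measure_pmf.expectation (round_choice n E) (\<lambda>f. ?g (S \<union> f ` S))
        \<le> measure_pmf.expectation (round_choice n E) (\<lambda>f. 1 / real (card (S \<union> f ` S)))"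
      by (intro expectation_mono_pmf finite_set_round_choice) auto
    also have "\<dots> \<le> (1/2 + 3 * \<delta> / 2) * (1 / real (card S))"
      using S True assms by (intro expectation_inverse_card_le) auto
    finally show ?thesis
      using True by simp
  next
    case False
    have fin: "finite S"
      using S finite_subset by blast
    have "real (card S) \<le> real (card (S \<union> f ` S))" for f
      using fin by (intro of_nat_mono card_mono) auto
    with False have "\<not> real (card (S \<union> f ` S)) < \<delta> * real n" for f
      by (meson order_le_less_trans)
    with False show ?thesis
      by simp
  qed
  have "measure_pmf.prob (push_run S t) {S. real (card S) < \<delta> * real n}
      \<le> measure_pmf.expectation (push_run S t) (\<lambda>S. \<delta> * real n * ?g S)"
  proof (rule prob_le_expectation[OF finite_set_push_run])
    fix S' assume S': "S' \<in> set_pmf (push_run S t)"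
    show "0 \<le> \<delta> * real n * ?g S'"
      using \<open>0 < \<delta>\<close> by simp
    assume "S' \<in> {S. real (card S) < \<delta> * real n}"
    moreover have "card S' \<ge> 1"
      using push_run_superset[OF S' S(1)] S(2) by (intro I) auto
    ultimately show "1 \<le> \<delta> * real n * ?g S'"
      by simp
  qed
  also have "\<dots> = \<delta> * real n * measure_pmf.expectation (push_run S t) ?g"
    by simp
  also have "\<dots> \<le> \<delta> * real n * ((1/2 + 3 * \<delta> / 2) ^ t * ?g S)"
    using S \<open>0 < \<delta>\<close> by (intro mult_left_mono expectation_run_pmf_le[where I = ?I]
        finite_set_round_choice inv step) auto
  also have "\<dots> \<le> \<delta> * real n * ((1/2 + 3 * \<delta> / 2) ^ t * 1)"
    using I[of S] S \<open>0 < \<delta>\<close> by (intro mult_left_mono) auto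
  finally show ?thesis by simp
qed

text \<open>The one-round estimate has an additive error of order n. While more than \<delta> n
  vertices are uninformed, this error is at most a multiple of their number and joins the
  contraction factor; below that threshold the potential is set to 0.\<close>

lemma middle_phase:
  assumes S: "S \<subseteq> {0..<n}" and large: "\<delta> * real n \<le> real (card S)" and "0 < \<delta>" "n > 0"
  shows "measure_pmf.prob (push_run S t) {S. \<delta> * real n < real (card ({0..<n} - S))}
    \<le> (exp (- \<delta> / 2) + 4 * \<eta>\<^sup>2 / \<delta>\<^sup>2) ^ t / \<delta>"
proof -
  let ?x = "\<lambda>S. real (card ({0..<n} - S))"
  let ?g = "\<lambda>S. if \<delta> * real n < ?x S then ?x S else 0 :: real"
  let ?\<rho> = "exp (- \<delta> / 2) + 4 * \<eta>\<^sup>2 / \<delta>\<^sup>2"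
  let ?I = "\<lambda>S. S \<subseteq> {0..<n} \<and> \<delta> * real n \<le> real (card S)"
  have \<rho>: "0 \<le> ?\<rho>"
    by (intro add_nonneg_nonneg) auto
  have inv: "?I (S \<union> f ` S)" if "?I S" "f \<in> set_pmf (round_choice n E)" for S f
  proof -
    have "finite S"
      using that finite_subset by blast
    then have "card S \<le> card (S \<union> f ` S)"
      by (intro card_mono) auto
    with that choice_image_subset[of f S] show ?thesis
      by (auto intro: order_trans[OF _ of_nat_mono])
  qed
  have step: "measure_pmf.expectation (round_choice n E) (\<lambda>f. ?g (S \<union> f ` S)) \<le> ?\<rho> * ?g S"
    if S: "?I S" for S
  proof (cases "\<delta> * real n < ?x S")
    case True
    have "measure_pmf.expectation (round_choice n E) (\<lambda>f. ?g (S \<union> f ` S))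
        \<le> measure_pmf.expectation (round_choice n E) (\<lambda>f. ?x (S \<union> f ` S))"
      by (intro expectation_mono_pmf finite_set_round_choice) auto
    also have "\<dots> \<le> exp (- \<delta> / 2) * ?x S + 4 * \<eta>\<^sup>2 / \<delta> * real n"
      using S assms by (intro expectation_uninformed_middle) auto
    also have "4 * \<eta>\<^sup>2 / \<delta> * real n = 4 * \<eta>\<^sup>2 / \<delta>\<^sup>2 * (\<delta> * real n)"
      using \<open>0 < \<delta>\<close> by (simp add: power2_eq_square)
    also have "exp (- \<delta> / 2) * ?x S + 4 * \<eta>\<^sup>2 / \<delta>\<^sup>2 * (\<delta> * real n)
        \<le> exp (- \<delta> / 2) * ?x S + 4 * \<eta>\<^sup>2 / \<delta>\<^sup>2 * ?x S"
      using True by (intro add_left_mono mult_left_mono) auto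
    finally show ?thesis
      using True by (simp add: distrib_right)
  next
    case False
    have "?x (S \<union> f ` S) \<le> ?x S" for f
      by (intro of_nat_mono card_mono) auto
    with False have "\<not> \<delta> * real n < ?x (S \<union> f ` S)" for f
      by (meson order_less_le_trans)
    with False show ?thesis
      by simp
  qed
  have pos: "\<delta> * real n > 0"
    using assms by simp
  have "measure_pmf.prob (push_run S t) {S. \<delta> * real n < ?x S}
      \<le> measure_pmf.expectation (push_run S t) (\<lambda>S. ?g S / (\<delta> * real n))"
    using pos by (intro prob_le_expectation[OF finite_set_push_run]) (auto simp: field_simps)
  also have "\<dots> = measure_pmf.expectation (push_run S t) ?g / (\<delta> * real n)"
    by simp
  also have "\<dots> \<le> (?\<rho> ^ t * ?g S) / (\<delta> * real n)"
    using pos S large \<rho> by (intro divide_right_mono expectation_run_pmf_le[where I = ?I]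
        finite_set_round_choice inv step) auto
  also have "\<dots> \<le> (?\<rho> ^ t * real n) / (\<delta> * real n)"
    using pos \<rho> card_mono[of "{0..<n}" "{0..<n} - S"]
    by (intro divide_right_mono mult_left_mono) auto
  finally show ?thesis
    using \<open>n > 0\<close> by simp
qed

lemma late_phase:
  assumes S: "S \<subseteq> {0..<n}" and large: "real (card ({0..<n} - S)) \<le> \<delta> * real n"
    and "0 < \<delta>" "n > 0"
  shows "measure_pmf.prob (push_run S t) (- {{0..<n}})
    \<le> real n * (exp (- (1 - 2 * \<delta>)) + \<eta>\<^sup>2 / \<delta>\<^sup>2) ^ t"
proof -
  let ?x = "\<lambda>S. real (card ({0..<n} - S))"
  let ?\<rho> = "exp (- (1 - 2 * \<delta>)) + \<eta>\<^sup>2 / \<delta>\<^sup>2"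
  let ?I = "\<lambda>S. S \<subseteq> {0..<n} \<and> ?x S \<le> \<delta> * real n"
  have \<rho>: "0 \<le> ?\<rho>"
    by (intro add_nonneg_nonneg) auto
  have inv: "?I (S \<union> f ` S)" if "?I S" "f \<in> set_pmf (round_choice n E)" for S f
  proof -
    have "?x (S \<union> f ` S) \<le> ?x S"
      by (intro of_nat_mono card_mono) auto
    with that choice_image_subset[of f S] show ?thesis
      by auto
  qed
  have "measure_pmf.prob (push_run S t) (- {{0..<n}}) \<le> measure_pmf.expectation (push_run S t) ?x"
  proof (rule prob_le_expectation[OF finite_set_push_run])
    fix S' assume "S' \<in> set_pmf (push_run S t)" "S' \<in> - {{0..<n}}"
    then have "{0..<n} - S' \<noteq> {}"
      using push_run_superset[OF _ S] by blast
    then have "card ({0..<n} - S') \<noteq> 0"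
      by simp
    then show "1 \<le> ?x S'"
      by linarith
  qed auto
  also have "\<dots> \<le> ?\<rho> ^ t * ?x S"
    using S large \<rho> assms by (intro expectation_run_pmf_le[where I = ?I] finite_set_round_choice
        inv expectation_uninformed_late) auto
  also have "\<dots> \<le> ?\<rho> ^ t * real n"
    using \<rho> card_mono[of "{0..<n}" "{0..<n} - S"] by (intro mult_left_mono) auto
  finally show ?thesis
    by (simp add: mult.commute)
qed

theorem prob_not_all_informed_le:
  assumes S: "S \<subseteq> {0..<n}" "S \<noteq> {}" and "\<eta> \<le> \<delta>" "0 < \<delta>" "\<delta> \<le> 1"
  shows "measure_pmf.prob (push_run S (t\<^sub>1 + (t\<^sub>2 + t\<^sub>3))) (- {{0..<n}})
    \<le> \<delta> * real n * (1/2 + 3 * \<delta> / 2) ^ t\<^sub>1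
      + ((exp (- \<delta> / 2) + 4 * \<eta>\<^sup>2 / \<delta>\<^sup>2) ^ t\<^sub>2 / \<delta>
      + real n * (exp (- (1 - 2 * \<delta>)) + \<eta>\<^sup>2 / \<delta>\<^sup>2) ^ t\<^sub>3)"
proof -
  have n: "n > 0"
    using S by auto
  have late0: "0 \<le> real n * (exp (- (1 - 2 * \<delta>)) + \<eta>\<^sup>2 / \<delta>\<^sup>2) ^ t\<^sub>3"
    by (intro mult_nonneg_nonneg zero_le_power add_nonneg_nonneg) auto
  have mid0: "0 \<le> (exp (- \<delta> / 2) + 4 * \<eta>\<^sup>2 / \<delta>\<^sup>2) ^ t\<^sub>2 / \<delta>"
    using \<open>0 < \<delta>\<close> by (intro divide_nonneg_nonneg zero_le_power add_nonneg_nonneg) auto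
  have mid: "measure_pmf.prob (push_run S' (t\<^sub>2 + t\<^sub>3)) (- {{0..<n}})
      \<le> (exp (- \<delta> / 2) + 4 * \<eta>\<^sup>2 / \<delta>\<^sup>2) ^ t\<^sub>2 / \<delta>
        + real n * (exp (- (1 - 2 * \<delta>)) + \<eta>\<^sup>2 / \<delta>\<^sup>2) ^ t\<^sub>3"
    if S': "S' \<subseteq> {0..<n}" "\<delta> * real n \<le> real (card S')" for S'
  proof (rule prob_run_pmf_add_le[OF finite_set_round_choice _ _ late0,
        where M = "{S. real (card ({0..<n} - S)) \<le> \<delta> * real n}"])
    show "measure_pmf.prob (push_run S' t\<^sub>2) (- {S. real (card ({0..<n} - S)) \<le> \<delta> * real n})
        \<le> (exp (- \<delta> / 2) + 4 * \<eta>\<^sup>2 / \<delta>\<^sup>2) ^ t\<^sub>2 / \<delta>"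
      using middle_phase[OF S' \<open>0 < \<delta>\<close> n, of t\<^sub>2] by (simp add: Collect_neg_eq[symmetric] not_le)
  next
    fix S'' assume "S'' \<in> set_pmf (push_run S' t\<^sub>2)" "S'' \<in> {S. real (card ({0..<n} - S)) \<le> \<delta> * real n}"
    then show "measure_pmf.prob (push_run S'' t\<^sub>3) (- {{0..<n}})
        \<le> real n * (exp (- (1 - 2 * \<delta>)) + \<eta>\<^sup>2 / \<delta>\<^sup>2) ^ t\<^sub>3"
      using push_run_superset[OF _ S'(1)] \<open>0 < \<delta>\<close> n by (intro late_phase) auto
  qed
  show ?thesis
  proof (rule prob_run_pmf_add_le[OF finite_set_round_choice,
        where M = "{S. \<delta> * real n \<le> real (card S)}"])
    show "measure_pmf.prob (push_run S t\<^sub>1) (- {S. \<delta> * real n \<le> real (card S)})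
        \<le> \<delta> * real n * (1/2 + 3 * \<delta> / 2) ^ t\<^sub>1"
      using early_phase[OF assms, of t\<^sub>1] by (simp add: Collect_neg_eq[symmetric] not_le)
  qed (use mid push_run_superset[OF _ S(1)] late0 mid0 in auto)
qed

end

section \<open>The lower bound\<close>

context regular_graph
begin

section \<open>Doubling, and comparison with the process in which all vertices push\<close>

lemma card_push_run_le:
  assumes "finite S" "S' \<in> set_pmf (run_pmf p (\<lambda>S f. S \<union> f ` S) S t)"
  shows "finite S' \<and> card S' \<le> 2 ^ t * card S"
  using assms
proof (induction t arbitrary: S)
  case (Suc t)
  then obtain f where f: "S' \<in> set_pmf (run_pmf p (\<lambda>S f. S \<union> f ` S) (S \<union> f ` S) t)"
    by auto
  have "card (S \<union> f ` S) \<le> 2 * card S"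
    using card_Un_le[of S "f ` S"] card_image_le[OF Suc.prems(1), of f] by simp
  then have "2 ^ t * card (S \<union> f ` S) \<le> 2 ^ t * (2 * card S)"
    by (rule mult_left_mono) simp
  with Suc.IH[OF _ f] Suc.prems(1) show ?case
    by (auto simp: mult_ac intro: order_trans)
qed simp

text \<open>A coupling: the same choices drive both processes and preserve the inclusion of their
  states. Once everyone pushes, the hits of a round no longer depend on the current state.\<close>

lemma prob_all_informed_le_all_push:
  assumes "S \<subseteq> S'" "S' \<subseteq> {0..<n}"
  shows "measure_pmf.prob (run_pmf (round_choice n E) (\<lambda>S f. S \<union> f ` S) S t) {S. {0..<n} \<subseteq> S}
    \<le> measure_pmf.prob (run_pmf (round_choice n E) (\<lambda>S f. S \<union> f ` {0..<n}) S' t) {S. {0..<n} \<subseteq> S}"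
  using assms
proof (induction t arbitrary: S S')
  case 0
  then show ?case by (auto simp: indicator_def)
next
  case (Suc t)
  note fin = finite_set_round_choice
  have "measure_pmf.expectation (round_choice n E) (\<lambda>f. measure_pmf.prob
      (run_pmf (round_choice n E) (\<lambda>S f. S \<union> f ` S) (S \<union> f ` S) t) {S. {0..<n} \<subseteq> S})
    \<le> measure_pmf.expectation (round_choice n E) (\<lambda>f. measure_pmf.prob
      (run_pmf (round_choice n E) (\<lambda>S f. S \<union> f ` {0..<n}) (S' \<union> f ` {0..<n}) t) {S. {0..<n} \<subseteq> S})"
  proof (intro expectation_mono_pmf fin Suc.IH)
    fix f assume f: "f \<in> set_pmf (round_choice n E)"
    show "S \<union> f ` S \<subseteq> S' \<union> f ` {0..<n}"
      using Suc.prems by auto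
    show "S' \<union> f ` {0..<n} \<subseteq> {0..<n}"
      using Suc.prems choice_image_subset[OF f order_refl] by auto
  qed
  then show ?case
    using fin by (simp add: prob_bind_pmf finite_set_run_pmf)
qed

text \<open>Factor by factor: a common neighbour contributes 1 - 2 / d, at most (1 - 1 / d)^2, and
  every other vertex contributes equally to both sides. This is the negative correlation.\<close>

lemma prob_pair_unhit_le:
  assumes "u < n" "u' < n" "u \<noteq> u'"
  shows "measure_pmf.prob (round_choice n E) {f. \<forall>w\<in>{0..<n}. f w \<notin> {u, u'}}
    \<le> ((1 - 1 / real d) ^ d)\<^sup>2"
proof -
  let ?q = "\<lambda>u w. if w \<in> nbrs E u then 1 - 1 / real d else 1"
  have "measure_pmf.prob (round_choice n E) {f. \<forall>w\<in>{0..<n}. f w \<notin> {u, u'}}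
      = (\<Prod>w\<in>{0..<n}. 1 - real (card (nbrs E w \<inter> {u, u'})) / real d)"
    by (rule prob_all_avoid) simp
  also have "\<dots> \<le> (\<Prod>w\<in>{0..<n}. ?q u w * ?q u' w)"
  proof (intro prod_mono conjI)
    fix w assume "w \<in> {0..<n}"
    then have "card (nbrs E w \<inter> {u, u'}) \<le> d"
      using card_mono[OF finite_nbrs, of "nbrs E w \<inter> {u, u'}" w] card_nbrs[of w] by simp
    then show "0 \<le> 1 - real (card (nbrs E w \<inter> {u, u'})) / real d"
      using d_pos by (simp add: field_simps)
    have "real (card (nbrs E w \<inter> {u, u'})) = of_bool (w \<in> nbrs E u) + of_bool (w \<in> nbrs E u')"
      using \<open>u \<noteq> u'\<close> by (auto simp: nbrs_def edge_sym[of w] Int_insert_right)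
    then show "1 - real (card (nbrs E w \<inter> {u, u'})) / real d \<le> ?q u w * ?q u' w"
      using d_pos by (auto simp: field_simps)
  qed
  also have "\<dots> = (1 - 1 / real d) ^ card ({0..<n} \<inter> nbrs E u) * (1 - 1 / real d) ^ card ({0..<n} \<inter> nbrs E u')"
    by (simp add: prod.distrib prod.If_cases)
  also have "\<dots> = ((1 - 1 / real d) ^ d)\<^sup>2"
    using assms nbrs_subset by (simp add: Int_absorb1 card_nbrs power2_eq_square)
  finally show ?thesis .
qed

text \<open>The probability that a given vertex receives nothing in a round in which all vertices
  push. It tends to 1/e, but is 0 for \<open>d = 1\<close>, so positivity is assumed below where it
  is needed.\<close>

definition miss :: real where
  "miss = (1 - 1 / real d) ^ d"

lemma miss_nonneg: "0 \<le> miss"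
  using d_pos by (simp add: miss_def)

lemma expectation_all_push:
  "measure_pmf.expectation (round_choice n E) (\<lambda>f. real (card ({0..<n} - (S \<union> f ` {0..<n}))))
    = miss * real (card ({0..<n} - S))"
proof -
  have "{0..<n} - (S \<union> f ` {0..<n}) = ({0..<n} - S) - f ` {0..<n}" for f
    by auto
  then have "measure_pmf.expectation (round_choice n E) (\<lambda>f. real (card ({0..<n} - (S \<union> f ` {0..<n}))))
      = (\<Sum>u\<in>{0..<n} - S. (1 - 1 / real d) ^ card (nbrs E u \<inter> {0..<n}))"
    by (simp add: expectation_card_unhit)
  also have "\<dots> = (\<Sum>u\<in>{0..<n} - S. miss)"
    using nbrs_subset by (intro sum.cong refl) (simp add: Int_absorb2 card_nbrs miss_def)
  finally show ?thesis
    by (simp add: mult.commute)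
qed

text \<open>\<open>pairs\<close> counts ordered pairs of distinct unhit vertices. The plain square
  would include the diagonal, which contracts only by \<open>miss\<close>; the factorial moment
  contracts by \<open>miss\<^sup>2\<close> and fits the potential argument.\<close>

lemma expectation_all_push_pairs:
  fixes pairs :: "nat set \<Rightarrow> real"
  defines "pairs \<equiv> \<lambda>S. (real (card ({0..<n} - S)))\<^sup>2 - real (card ({0..<n} - S))"
  shows "measure_pmf.expectation (round_choice n E) (\<lambda>f. pairs (S \<union> f ` {0..<n}))
    \<le> miss\<^sup>2 * pairs S"
proof -
  let ?U = "{0..<n} - S"
  have count: "x\<^sup>2 - x = x * (x - 1)" for x :: real
    by (simp add: power2_eq_square algebra_simps)
  have card1: "real (card (A - {u})) = real (card A) - 1" if "finite A" "u \<in> A" for A and u :: nat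
    using that card_gt_0_iff[of A] by (subst card_Diff_singleton) (auto simp: of_nat_diff Suc_le_eq)
  have "pairs (S \<union> f ` {0..<n})
      = (\<Sum>u\<in>?U. \<Sum>u'\<in>?U - {u}. indicator {f. \<forall>w\<in>{0..<n}. f w \<notin> {u, u'}} f)" for f
  proof -
    let ?U' = "{0..<n} - (S \<union> f ` {0..<n})"
    have "pairs (S \<union> f ` {0..<n}) = (\<Sum>u\<in>?U'. real (card ?U') - 1)"
      by (simp add: pairs_def count)
    also have "\<dots> = (\<Sum>u\<in>?U'. real (card (?U' - {u})))"
      by (intro sum.cong refl card1[symmetric]) auto
    also have "\<dots> = (\<Sum>u\<in>?U. of_bool (u \<notin> f ` {0..<n}) * real (card (?U' - {u})))"
      by (rule sum.mono_neutral_cong_left) auto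
    also have "\<dots> = (\<Sum>u\<in>?U. \<Sum>u'\<in>?U - {u}. of_bool (u \<notin> f ` {0..<n}) * of_bool (u' \<notin> f ` {0..<n}))"
    proof (intro sum.cong refl)
      fix u
      have "?U' - {u} = {u'\<in>?U - {u}. u' \<notin> f ` {0..<n}}"
        by auto
      then have "real (card (?U' - {u})) = (\<Sum>u'\<in>?U - {u}. of_bool (u' \<notin> f ` {0..<n}))"
        by (simp only: sum_of_bool_card finite_Diff finite_atLeastLessThan)
      then show "of_bool (u \<notin> f ` {0..<n}) * real (card (?U' - {u}))
          = (\<Sum>u'\<in>?U - {u}. of_bool (u \<notin> f ` {0..<n}) * of_bool (u' \<notin> f ` {0..<n}))"
        by (simp only: sum_distrib_left)
    qed
    also have "\<dots> = (\<Sum>u\<in>?U. \<Sum>u'\<in>?U - {u}. indicator {f. \<forall>w\<in>{0..<n}. f w \<notin> {u, u'}} f)"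
      by (intro sum.cong refl) (auto simp: indicator_def)
    finally show ?thesis .
  qed
  then have "measure_pmf.expectation (round_choice n E) (\<lambda>f. pairs (S \<union> f ` {0..<n}))
      = measure_pmf.expectation (round_choice n E)
          (\<lambda>f. \<Sum>u\<in>?U. \<Sum>u'\<in>?U - {u}. indicator {f. \<forall>w\<in>{0..<n}. f w \<notin> {u, u'}} f)"
    by (simp only:)
  also have "\<dots> = (\<Sum>u\<in>?U. \<Sum>u'\<in>?U - {u}. measure_pmf.prob (round_choice n E) {f. \<forall>w\<in>{0..<n}. f w \<notin> {u, u'}})"
    by (simp add: integrable_measure_pmf_finite[OF finite_set_round_choice] del: insert_iff)
  also have "\<dots> \<le> (\<Sum>u\<in>?U. \<Sum>u'\<in>?U - {u}. miss\<^sup>2)"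
    unfolding miss_def by (intro sum_mono prob_pair_unhit_le) auto
  also have "\<dots> = (\<Sum>u\<in>?U. (real (card ?U) - 1) * miss\<^sup>2)"
  proof (intro sum.cong refl)
    fix u assume "u \<in> ?U"
    then have "real (card (?U - {u})) = real (card ?U) - 1"
      by (intro card1) auto
    then show "(\<Sum>u'\<in>?U - {u}. miss\<^sup>2) = (real (card ?U) - 1) * miss\<^sup>2"
      by (simp only: sum_constant)
  qed
  also have "\<dots> = miss\<^sup>2 * pairs S"
    by (simp add: pairs_def count)
  finally show ?thesis .
qed

text \<open>Chebyshev's inequality for the number of vertices that are never hit.\<close>
lemma prob_all_hit_le:
  assumes "0 < miss" "{0..<n} - S \<noteq> {}"
  shows "measure_pmf.prob (run_pmf (round_choice n E) (\<lambda>S f. S \<union> f ` {0..<n}) S t) {S. {0..<n} \<subseteq> S}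
    \<le> 1 / (miss ^ t * real (card ({0..<n} - S)))"
proof -
  let ?R = "run_pmf (round_choice n E) (\<lambda>S f. S \<union> f ` {0..<n}) S t"
  let ?x = "\<lambda>S. real (card ({0..<n} - S))"
  define \<mu> where "\<mu> = miss ^ t * ?x S"
  have fin: "finite (set_pmf ?R)"
    by (intro finite_set_run_pmf finite_set_round_choice)
  note intg = integrable_measure_pmf_finite[OF fin]
  have \<mu>: "\<mu> > 0"
    using assms by (simp add: \<mu>_def card_gt_0_iff)
  have mean: "measure_pmf.expectation ?R ?x = \<mu>"
    unfolding \<mu>_def
    by (intro antisym expectation_run_pmf_le[where I = "\<lambda>_. True"] expectation_run_pmf_ge[where I = "\<lambda>_. True"]
        finite_set_round_choice miss_nonneg) (simp_all add: expectation_all_push)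
  have "measure_pmf.expectation ?R (\<lambda>S. (?x S)\<^sup>2 - ?x S) \<le> (miss\<^sup>2) ^ t * ((?x S)\<^sup>2 - ?x S)"
    by (intro expectation_run_pmf_le[where I = "\<lambda>_. True"] finite_set_round_choice expectation_all_push_pairs) auto
  also have "\<dots> \<le> (miss\<^sup>2) ^ t * (?x S)\<^sup>2"
    by (intro mult_left_mono) auto
  also have "\<dots> = \<mu>\<^sup>2"
    by (simp add: \<mu>_def power_mult_distrib power_mult[symmetric] mult.commute)
  \<comment> \<open>The mean is exactly \<mu>, so the variance is at most \<mu> and Chebyshev's
    inequality gives \<mu> / \<mu>^2.\<close>
  finally have sq: "measure_pmf.expectation ?R (\<lambda>S. (?x S)\<^sup>2) \<le> \<mu>\<^sup>2 + \<mu>"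
    by (simp add: intg mean)
  have "measure_pmf.prob ?R {S. {0..<n} \<subseteq> S} \<le> measure_pmf.expectation ?R (\<lambda>S. (?x S - \<mu>)\<^sup>2 / \<mu>\<^sup>2)"
  proof (rule prob_le_expectation[OF fin])
    fix S' assume "S' \<in> {S. {0..<n} \<subseteq> S}"
    then have "{0..<n} - S' = {}"
      by auto
    then have "?x S' = 0"
      by (simp only: card.empty of_nat_0)
    then show "1 \<le> (?x S' - \<mu>)\<^sup>2 / \<mu>\<^sup>2"
      unfolding \<open>?x S' = 0\<close> using \<mu> by simp
  qed simp
  also have "\<dots> = measure_pmf.expectation ?R (\<lambda>S. (?x S)\<^sup>2 - 2 * \<mu> * ?x S + \<mu>\<^sup>2) / \<mu>\<^sup>2"
    by (simp add: power2_diff algebra_simps)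
  also have "measure_pmf.expectation ?R (\<lambda>S. (?x S)\<^sup>2 - 2 * \<mu> * ?x S + \<mu>\<^sup>2)
      = measure_pmf.expectation ?R (\<lambda>S. (?x S)\<^sup>2) - 2 * \<mu> * \<mu> + \<mu>\<^sup>2"
    by (simp add: intg mean)
  also have "\<dots> \<le> \<mu>"
    using sq by (simp add: power2_eq_square)
  also have "\<mu> / \<mu>\<^sup>2 = 1 / \<mu>"
    by (simp add: power2_eq_square)
  finally show ?thesis
    using \<mu> by (simp add: divide_right_mono \<mu>_def)
qed

theorem prob_all_informed_le:
  assumes "v < n" "0 < miss" "2 * 2 ^ a \<le> n"
  shows "measure_pmf.prob (run_pmf (round_choice n E) (\<lambda>S f. S \<union> f ` S) {v} (a + b)) {S. {0..<n} \<subseteq> S}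
    \<le> 2 / (miss ^ b * real n)"
proof -
  have "measure_pmf.prob (run_pmf (round_choice n E) (\<lambda>S f. S \<union> f ` S) {v} (a + b)) {S. {0..<n} \<subseteq> S}
      \<le> 0 + 2 / (miss ^ b * real n)"
  \<comment> \<open>\<open>M = UNIV\<close> with error 0: doubling leaves at least n / 2 vertices
    uninformed after \<open>a\<close> rounds with certainty.\<close>
  proof (rule prob_run_pmf_add_le[OF finite_set_round_choice, where M = UNIV])
    fix S assume S: "S \<in> set_pmf (run_pmf (round_choice n E) (\<lambda>S f. S \<union> f ` S) {v} a)"
    have sub: "S \<subseteq> {0..<n}"
      by (rule run_pmf_invariant[OF _ _ S]) (use assms choice_image_subset in auto)
    have "finite S" "card S \<le> 2 ^ a"
      using card_push_run_le[OF _ S] by auto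
    then have "2 * card ({0..<n} - S) \<ge> n"
      using sub assms(3) by (simp add: card_Diff_subset)
    then have half: "real n / 2 \<le> real (card ({0..<n} - S))"
      by linarith
    have ne: "{0..<n} - S \<noteq> {}"
    proof
      assume "{0..<n} - S = {}"
      with half have "real n / 2 \<le> 0"
        by (simp only: card.empty of_nat_0)
      with \<open>v < n\<close> show False
        by simp
    qed
    have "measure_pmf.prob (run_pmf (round_choice n E) (\<lambda>S f. S \<union> f ` S) S b) {S. {0..<n} \<subseteq> S}
        \<le> 1 / (miss ^ b * real (card ({0..<n} - S)))"
      using prob_all_informed_le_all_push[OF order_refl sub] prob_all_hit_le[OF assms(2) ne]
      by (rule order_trans)
    also have "\<dots> \<le> 1 / (miss ^ b * (real n / 2))"
      using half assms by (intro divide_left_mono mult_left_mono mult_pos_pos) auto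
    finally show "measure_pmf.prob (run_pmf (round_choice n E) (\<lambda>S f. S \<union> f ` S) S b) {S. {0..<n} \<subseteq> S}
        \<le> 2 / (miss ^ b * real n)"
      by simp
  qed (use miss_nonneg in simp_all)
  then show ?thesis
    by simp
qed

end

section \<open>Asymptotics\<close>

text \<open>The real number \<open>x\<close> is the intended length of a phase and \<open>t\<close>
  its rounding up; rounding only helps because the rate is nonnegative.\<close>

lemma power_le_exp:
  fixes \<rho> r x :: real
  assumes "0 \<le> \<rho>" "\<rho> \<le> exp (- r)" "0 \<le> r" "x \<le> real t"
  shows "\<rho> ^ t \<le> exp (- r * x)"
proof -
  have "\<rho> ^ t \<le> exp (- r) ^ t"
    using assms by (intro power_mono)
  also have "\<dots> = exp (- r * real t)"
    by (simp add: mult.commute flip: exp_of_nat_mult)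
  also have "\<dots> \<le> exp (- r * x)"
    using assms by (simp add: mult_left_mono)
  finally show ?thesis .
qed

lemma power_ge_exp:
  fixes \<rho> r x :: real
  assumes "exp (- r) \<le> \<rho>" "0 \<le> r" "real t \<le> x"
  shows "exp (- r * x) \<le> \<rho> ^ t"
proof -
  have "exp (- r * x) \<le> exp (- r * real t)"
    using assms by (simp add: mult_left_mono)
  also have "\<dots> = exp (- r) ^ t"
    by (simp add: mult.commute flip: exp_of_nat_mult)
  also have "\<dots> \<le> \<rho> ^ t"
    using assms by (intro power_mono) auto
  finally show ?thesis .
qed

text \<open>Dividing \<open>degree_into_variance\<close> by d^2 turns the bound C sqrt d into \<eta>
  = C sqrt d / d.\<close>

lemma expander_of_second_eig:
  assumes G: "simple_graph n E" "connected_graph n E" "regular n E d" "n \<ge> 2"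
    and "d > 0" "C > 0" "second_eig n E \<le> C * sqrt d"
  shows "expander n E d (C / sqrt d)"
proof -
  interpret regular_graph n E d
    using assms by unfold_locales
  show ?thesis
  proof
    show "0 \<le> C / sqrt d"
      using assms by simp
    fix S assume "S \<subseteq> {0..<n}"
    then have S: "S \<subseteq> {..<n}"
      by (simp add: atLeast0LessThan)
    have "(nfrac u S - real (card S) / real n)\<^sup>2
        = (real (card (nbrs E u \<inter> S)) - real d * real (card S) / real n)\<^sup>2 / (real d)\<^sup>2" for u
    proof -
      have "nfrac u S - real (card S) / real n
          = (real (card (nbrs E u \<inter> S)) - real d * real (card S) / real n) / real d"
        using \<open>d > 0\<close> by (simp add: nfrac_def diff_divide_distrib)
      then show ?thesis
        by (simp only: power_divide)
    qed
    then have "(\<Sum>u<n. (nfrac u S - real (card S) / real n)\<^sup>2)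
        = (\<Sum>u<n. (real (card (nbrs E u \<inter> S)) - real d * real (card S) / real n)\<^sup>2) / (real d)\<^sup>2"
      by (simp only: sum_divide_distrib)
    also have "\<dots> \<le> ((C * sqrt d)\<^sup>2 * real (card S)) / (real d)\<^sup>2"
      using assms by (intro divide_right_mono degree_into_variance[OF G _ S]) auto
    also have "\<dots> = (C / sqrt d)\<^sup>2 * real (card S)"
      using \<open>d > 0\<close> by (simp add: power_mult_distrib power_divide power2_eq_square[of "real d"])
    finally show "(\<Sum>u<n. (nfrac u S - real (card S) / real n)\<^sup>2) \<le> (C / sqrt d)\<^sup>2 * real (card S)" .
  qed
qed

text \<open>Continuity at \<delta> = 0, where the two products are 1 + (ln 2) \<epsilon> / 8 and 1 +
  \<epsilon> / 8. Exceeding 1 is what beats the factor n in the early and the late phase. The bound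
  1/4 keeps both decay rates positive.\<close>

lemma phase_parameter:
  fixes \<epsilon> :: real
  assumes "\<epsilon> > 0"
  obtains \<delta> :: real where "0 < \<delta>" "\<delta> \<le> 1 / 4"
    "1 < - ln (1/2 + 3 * \<delta> / 2) * (1 / ln 2 + \<epsilon> / 8)" "1 < (1 - 3 * \<delta>) * (1 + \<epsilon> / 8)"
proof -
  have "((\<lambda>\<delta>::real. - ln (1/2 + 3 * \<delta> / 2) * (1 / ln 2 + \<epsilon> / 8))
      \<longlongrightarrow> - ln (1/2 + 3 * 0 / 2) * (1 / ln 2 + \<epsilon> / 8)) (at_right 0)"
    by (intro tendsto_intros) auto
  moreover have "1 < - ln (1/2 + 3 * 0 / 2) * (1 / ln 2 + \<epsilon> / 8)"
    using assms by (simp add: ln_div distrib_left)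
  ultimately have 1: "eventually (\<lambda>\<delta>. 1 < - ln (1/2 + 3 * \<delta> / 2) * (1 / ln 2 + \<epsilon> / 8)) (at_right 0)"
    by (rule order_tendstoD)
  have "((\<lambda>\<delta>::real. (1 - 3 * \<delta>) * (1 + \<epsilon> / 8)) \<longlongrightarrow> (1 - 3 * 0) * (1 + \<epsilon> / 8)) (at_right 0)"
    by (intro tendsto_intros)
  then have 2: "eventually (\<lambda>\<delta>. 1 < (1 - 3 * \<delta>) * (1 + \<epsilon> / 8)) (at_right 0)"
    by (rule order_tendstoD) (use assms in simp)
  have 3: "eventually (\<lambda>\<delta>::real. \<delta> \<in> {0<..<1/4}) (at_right 0)"
    by (rule eventually_at_right_real) simp
  have "eventually (\<lambda>\<delta>. 0 < \<delta> \<and> \<delta> \<le> 1 / 4 \<and> 1 < - ln (1/2 + 3 * \<delta> / 2) * (1 / ln 2 + \<epsilon> / 8)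
      \<and> 1 < (1 - 3 * \<delta>) * (1 + \<epsilon> / 8)) (at_right (0::real))"
    using 1 2 3 by eventually_elim auto
  then show thesis
    using eventually_happens'[of "at_right (0::real)"] that by auto
qed

lemma degree_tendsto_at_top:
  fixes n d :: "nat \<Rightarrow> nat"
  assumes "C > 0" "filterlim n at_top sequentially"
    and deg: "eventually (\<lambda>k. real (d k) \<ge> 2 * C * sqrt (n k * ln (n k) powr (1/9))) sequentially"
  shows "filterlim d at_top sequentially"
proof -
  have n: "filterlim (\<lambda>k. real (n k)) at_top sequentially"
    by (rule filterlim_compose[OF filterlim_real_sequentially assms(2)])
  have "filterlim (\<lambda>x::real. 2 * C * sqrt (x * ln x powr (1/9))) at_top at_top"
    using \<open>C > 0\<close> by real_asymp
  then have "filterlim (\<lambda>k. 2 * C * sqrt (n k * ln (n k) powr (1/9))) at_top sequentially"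
    using n by (rule filterlim_compose)
  then have "filterlim (\<lambda>k. real (d k)) at_top sequentially"
    using deg by (rule filterlim_at_top_mono)
  then show ?thesis
    by (simp add: filterlim_sequentially_iff_filterlim_real)
qed

lemma exp_neg_ln_tendsto_0:
  fixes L :: "nat \<Rightarrow> real"
  assumes "filterlim L at_top sequentially" "c < 0"
  shows "(\<lambda>k. exp (c * L k)) \<longlonglongrightarrow> 0"
proof -
  have "((\<lambda>x::real. exp (c * x)) \<longlongrightarrow> 0) at_top"
    using assms(2) by real_asymp
  then show ?thesis
    using assms(1) by (rule filterlim_compose)
qed

lemma push_time_upper_tail:
  fixes C :: real
    and n :: "nat \<Rightarrow> nat" and E :: "nat \<Rightarrow> nat \<Rightarrow> nat \<Rightarrow> bool"
    and d :: "nat \<Rightarrow> nat" and v :: "nat \<Rightarrow> nat"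
  assumes "C > 0" "\<epsilon> > 0" and n: "filterlim n at_top sequentially" and d: "filterlim d at_top sequentially"
    and G: "eventually (\<lambda>k. expander (n k) (E k) (d k) (C / sqrt (d k)) \<and> v k < n k) sequentially"
  obtains b where
    "eventually (\<lambda>k. real (b k) \<le> log 2 (n k) + ln (n k) + \<epsilon> * ln (n k)) sequentially"
    "(\<lambda>k. measure_pmf.prob (run_pmf (round_choice (n k) (E k)) (\<lambda>S f. S \<union> f ` S) {v k} (b k))
      (- {{0..<n k}})) \<longlonglongrightarrow> 0"
proof -
  obtain \<delta> where \<delta>: "0 < \<delta>" "\<delta> \<le> 1 / 4" and c1: "1 < - ln (1/2 + 3 * \<delta> / 2) * (1 / ln 2 + \<epsilon> / 8)"
    and c3: "1 < (1 - 3 * \<delta>) * (1 + \<epsilon> / 8)"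
    using phase_parameter[OF \<open>\<epsilon> > 0\<close>] by blast
  define r where "r = - ln (1/2 + 3 * \<delta> / 2)"
  have r: "0 \<le> r" "exp (- r) = 1/2 + 3 * \<delta> / 2"
    using \<delta> by (simp_all add: r_def)
  define L where "L = (\<lambda>k. ln (real (n k)))"
  have L: "filterlim L at_top sequentially"
    unfolding L_def using n
    by (intro filterlim_compose[OF ln_at_top] filterlim_compose[OF filterlim_real_sequentially])
  define \<eta> where "\<eta> = (\<lambda>k. C / sqrt (real (d k)))"
  have \<eta>: "\<eta> \<longlonglongrightarrow> 0"
    unfolding \<eta>_def using d
    by (intro tendsto_divide_0[OF tendsto_const] filterlim_at_top_imp_at_infinity
        filterlim_compose[OF sqrt_at_top] filterlim_compose[OF filterlim_real_sequentially])
  \<comment> \<open>Each phase receives a slack of \<epsilon> / 8 times ln n. Rounding up costs at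
    most 3 in total, which the remaining 5/8 of \<epsilon> ln n covers once \<epsilon> ln n exceeds
    5.\<close>
  define b\<^sub>1 b\<^sub>2 b\<^sub>3 where "b\<^sub>1 = (\<lambda>k. nat \<lceil>(1 / ln 2 + \<epsilon> / 8) * L k\<rceil>)"
    and "b\<^sub>2 = (\<lambda>k. nat \<lceil>\<epsilon> / 8 * L k\<rceil>)" and "b\<^sub>3 = (\<lambda>k. nat \<lceil>(1 + \<epsilon> / 8) * L k\<rceil>)"
  define b where "b = (\<lambda>k. b\<^sub>1 k + (b\<^sub>2 k + b\<^sub>3 k))"
  have b_le: "eventually (\<lambda>k. real (b k) \<le> log 2 (n k) + ln (n k) + \<epsilon> * ln (n k)) sequentially"
    using filterlim_at_top_dense[THEN iffD1, OF L, rule_format, of "5 / \<epsilon>"]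
      filterlim_at_top_dense[THEN iffD1, OF L, rule_format, of 0]
  proof eventually_elim
    case (elim k)
    have nonneg: "0 \<le> (1 / ln 2 + \<epsilon> / 8) * L k" "0 \<le> \<epsilon> / 8 * L k" "0 \<le> (1 + \<epsilon> / 8) * L k"
      using elim \<open>\<epsilon> > 0\<close> by (auto intro!: mult_nonneg_nonneg add_nonneg_nonneg)
    have ceil: "real (nat \<lceil>x\<rceil>) \<le> x + 1" if "0 \<le> x" for x :: real
      using that by linarith
    have "real (b k) \<le> ((1 / ln 2 + \<epsilon> / 8) * L k + 1) + ((\<epsilon> / 8 * L k + 1) + ((1 + \<epsilon> / 8) * L k + 1))"
      unfolding b_def b\<^sub>1_def b\<^sub>2_def b\<^sub>3_def of_nat_add by (intro add_mono ceil nonneg)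
    also have "\<dots> = L k / ln 2 + L k + 3 / 8 * (\<epsilon> * L k) + 3"
      by (simp add: algebra_simps)
    also have "5 < \<epsilon> * L k"
      using elim \<open>\<epsilon> > 0\<close> by (simp add: field_simps)
    then have "L k / ln 2 + L k + 3 / 8 * (\<epsilon> * L k) + 3 \<le> L k / ln 2 + L k + \<epsilon> * L k"
      by linarith
    finally show ?case
      by (simp add: log_def L_def)
  qed
  let ?F = "\<lambda>k. exp ((1 - r * (1 / ln 2 + \<epsilon> / 8)) * L k)
    + (exp (- (\<delta> / 4 * (\<epsilon> / 8)) * L k) / \<delta> + exp ((1 - (1 - 3 * \<delta>) * (1 + \<epsilon> / 8)) * L k))"
  have F: "?F \<longlonglongrightarrow> 0 + (0 / \<delta> + 0)"
    using c1 c3 \<delta> \<open>\<epsilon> > 0\<close> by (intro tendsto_add tendsto_divide exp_neg_ln_tendsto_0[OF L] tendsto_const)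
      (auto simp: r_def)
  have "(\<lambda>k. exp (- \<delta> / 2) + 4 * (\<eta> k)\<^sup>2 / \<delta>\<^sup>2) \<longlonglongrightarrow> exp (- \<delta> / 2) + 4 * 0\<^sup>2 / \<delta>\<^sup>2"
    using \<delta> by (intro tendsto_intros \<eta>) auto
  \<comment> \<open>Halving the rate from \<delta> / 2 to \<delta> / 4 absorbs the \<eta> term; in
    the late phase the step from 2 \<delta> to 3 \<delta> does the same.\<close>
  then have e2: "eventually (\<lambda>k. exp (- \<delta> / 2) + 4 * (\<eta> k)\<^sup>2 / \<delta>\<^sup>2 < exp (- (\<delta> / 4))) sequentially"
    by (rule order_tendstoD) (use \<delta> in simp)
  have "(\<lambda>k. exp (- (1 - 2 * \<delta>)) + (\<eta> k)\<^sup>2 / \<delta>\<^sup>2) \<longlonglongrightarrow> exp (- (1 - 2 * \<delta>)) + 0\<^sup>2 / \<delta>\<^sup>2"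
    using \<delta> by (intro tendsto_intros \<eta>) auto
  then have e3: "eventually (\<lambda>k. exp (- (1 - 2 * \<delta>)) + (\<eta> k)\<^sup>2 / \<delta>\<^sup>2 < exp (- (1 - 3 * \<delta>))) sequentially"
    by (rule order_tendstoD) (use \<delta> in simp)
  have e1: "eventually (\<lambda>k. \<eta> k < \<delta>) sequentially"
    using \<eta> \<delta>(1) by (rule order_tendstoD)
  have le: "eventually (\<lambda>k. measure_pmf.prob
      (run_pmf (round_choice (n k) (E k)) (\<lambda>S f. S \<union> f ` S) {v k} (b k)) (- {{0..<n k}}) \<le> ?F k) sequentially"
    using e1 e2 e3 G filterlim_at_top_dense[THEN iffD1, OF L, rule_format, of 0]
  proof eventually_elim
    case (elim k)
    interpret expander "n k" "E k" "d k" "\<eta> k"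
      using elim by (simp add: \<eta>_def)
    have nk: "real (n k) = exp (L k)"
      using elim by (simp add: L_def)
    have ge: "x \<le> real (nat \<lceil>x\<rceil>)" for x :: real
      by linarith
    have p1: "(1/2 + 3 * \<delta> / 2) ^ b\<^sub>1 k \<le> exp (- r * ((1 / ln 2 + \<epsilon> / 8) * L k))"
      using r \<delta> unfolding b\<^sub>1_def by (intro power_le_exp ge) auto
    have p2: "(exp (- \<delta> / 2) + 4 * (\<eta> k)\<^sup>2 / \<delta>\<^sup>2) ^ b\<^sub>2 k \<le> exp (- (\<delta> / 4) * (\<epsilon> / 8 * L k))"
      using elim \<delta> unfolding b\<^sub>2_def by (intro power_le_exp ge) (auto intro: add_nonneg_nonneg)
    have p3: "(exp (- (1 - 2 * \<delta>)) + (\<eta> k)\<^sup>2 / \<delta>\<^sup>2) ^ b\<^sub>3 k \<le> exp (- (1 - 3 * \<delta>) * ((1 + \<epsilon> / 8) * L k))"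
      using elim \<delta> unfolding b\<^sub>3_def by (intro power_le_exp ge) (auto intro: add_nonneg_nonneg)
    have "measure_pmf.prob (push_run {v k} (b k)) (- {{0..<n k}})
      \<le> \<delta> * real (n k) * (1/2 + 3 * \<delta> / 2) ^ b\<^sub>1 k
        + ((exp (- \<delta> / 2) + 4 * (\<eta> k)\<^sup>2 / \<delta>\<^sup>2) ^ b\<^sub>2 k / \<delta>
        + real (n k) * (exp (- (1 - 2 * \<delta>)) + (\<eta> k)\<^sup>2 / \<delta>\<^sup>2) ^ b\<^sub>3 k)"
      unfolding b_def using elim \<delta> by (intro prob_not_all_informed_le) auto
    also have "\<dots> \<le> 1 * real (n k) * exp (- r * ((1 / ln 2 + \<epsilon> / 8) * L k))
        + (exp (- (\<delta> / 4) * (\<epsilon> / 8 * L k)) / \<delta>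
        + real (n k) * exp (- (1 - 3 * \<delta>) * ((1 + \<epsilon> / 8) * L k)))"
      using \<delta> by (intro add_mono mult_mono divide_right_mono p1 p2 p3 order_refl) auto
    also have "\<dots> = ?F k"
      unfolding nk by (simp add: algebra_simps add_divide_distrib diff_divide_distrib flip: exp_add)
    finally show ?case .
  qed
  have "(\<lambda>k. measure_pmf.prob (run_pmf (round_choice (n k) (E k)) (\<lambda>S f. S \<union> f ` S) {v k} (b k))
      (- {{0..<n k}})) \<longlonglongrightarrow> 0"
    by (rule tendsto_sandwich[OF _ le tendsto_const]) (use F in auto)
  with b_le show thesis
    by (rule that)
qed

lemma push_time_lower_tail:
  fixes n :: "nat \<Rightarrow> nat" and E :: "nat \<Rightarrow> nat \<Rightarrow> nat \<Rightarrow> bool"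
    and d :: "nat \<Rightarrow> nat" and v :: "nat \<Rightarrow> nat"
  assumes "\<epsilon> > 0" and n: "filterlim n at_top sequentially" and d: "filterlim d at_top sequentially"
    and G: "eventually (\<lambda>k. regular_graph (n k) (E k) (d k) \<and> v k < n k) sequentially"
  obtains a where
    "eventually (\<lambda>k. log 2 (n k) + ln (n k) - \<epsilon> * ln (n k) \<le> real (a k)) sequentially"
    "(\<lambda>k. measure_pmf.prob (run_pmf (round_choice (n k) (E k)) (\<lambda>S f. S \<union> f ` S) {v k} (a k))
      {S. {0..<n k} \<subseteq> S}) \<longlonglongrightarrow> 0"
proof -
  \<comment> \<open>\<open>e < 1\<close> keeps the second stretch of positive length, and
    \<open>e < \<epsilon>\<close> leaves (\<epsilon> - e) ln n to pay for a loss of 3: one round for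
    reaching only n / 2, and two roundings down.\<close>
  define e where "e = min \<epsilon> 1 / 2"
  have e: "0 < e" "e < 1" "e < \<epsilon>"
    using \<open>\<epsilon> > 0\<close> by (auto simp: e_def)
  define L where "L = (\<lambda>k. ln (real (n k)))"
  have L: "filterlim L at_top sequentially"
    unfolding L_def using n
    by (intro filterlim_compose[OF ln_at_top] filterlim_compose[OF filterlim_real_sequentially])
  define a\<^sub>1 a\<^sub>2 where "a\<^sub>1 = (\<lambda>k. nat \<lfloor>log 2 (n k) - 1\<rfloor>)" and "a\<^sub>2 = (\<lambda>k. nat \<lfloor>(1 - e) * L k\<rfloor>)"
  define a where "a = (\<lambda>k. a\<^sub>1 k + a\<^sub>2 k)"
  have le_a: "eventually (\<lambda>k. log 2 (n k) + ln (n k) - \<epsilon> * ln (n k) \<le> real (a k)) sequentially"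
    using filterlim_at_top_dense[THEN iffD1, OF L, rule_format, of "3 / (\<epsilon> - e)"]
  proof eventually_elim
    case (elim k)
    have floor: "x - 1 \<le> real (nat \<lfloor>x\<rfloor>)" for x :: real
      by linarith
    have "3 < (\<epsilon> - e) * L k"
      using elim e by (simp add: field_simps)
    then have "log 2 (n k) + L k - \<epsilon> * L k \<le> (log 2 (n k) - 1 - 1) + ((1 - e) * L k - 1)"
      by (simp add: algebra_simps)
    also have "\<dots> \<le> real (a k)"
      unfolding a_def a\<^sub>1_def a\<^sub>2_def of_nat_add by (intro add_mono floor)
    finally show ?case
      by (simp add: L_def)
  qed
  have "(\<lambda>m. (1 + (-1) / real m) ^ m) \<longlonglongrightarrow> exp (- 1)"
    by (rule tendsto_exp_limit_sequentially)
  then have "(\<lambda>k. (1 + (-1) / real (d k)) ^ d k) \<longlonglongrightarrow> exp (- 1)"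
    using d by (rule filterlim_compose)
  then have miss: "eventually (\<lambda>k. exp (- (1 + e)) < (1 + (-1) / real (d k)) ^ d k) sequentially"
    by (rule order_tendstoD) (use e in simp)
  have "(\<lambda>k. 2 * exp (- (e * e) * L k)) \<longlonglongrightarrow> 2 * 0"
    using e by (intro tendsto_mult tendsto_const exp_neg_ln_tendsto_0[OF L]) simp
  then have F: "(\<lambda>k. 2 * exp (- (e * e) * L k)) \<longlonglongrightarrow> 0"
    by simp
  have le: "eventually (\<lambda>k. measure_pmf.prob
      (run_pmf (round_choice (n k) (E k)) (\<lambda>S f. S \<union> f ` S) {v k} (a k)) {S. {0..<n k} \<subseteq> S}
      \<le> 2 * exp (- (e * e) * L k)) sequentially"
    \<comment> \<open>ln n > ln 2 makes log_2 n - 1 nonnegative, so that \<open>nat\<close> in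
      \<open>a\<^sub>1\<close> does not round a negative number up to 0.\<close>
    using miss G filterlim_at_top_dense[THEN iffD1, OF L, rule_format, of "ln 2"]
  proof eventually_elim
    case (elim k)
    interpret regular_graph "n k" "E k" "d k"
      using elim by simp
    have Lpos: "L k > 0"
      using elim ln_gt_zero[of "2::real"] by linarith
    have nk: "real (n k) = exp (L k)"
      using elim by (simp add: L_def)
    have miss_gt: "exp (- (1 + e)) < miss"
      using elim by (simp add: miss_def)
    then have miss_pos: "0 < miss"
      by (rule order_less_trans[rotated]) simp
    have "log 2 (n k) \<ge> 1"
      using elim by (simp add: log_def L_def)
    then have "real (a\<^sub>1 k) \<le> log 2 (n k) - 1"
      unfolding a\<^sub>1_def by linarith
    then have "2 powr real (a\<^sub>1 k) \<le> 2 powr (log 2 (n k) - 1)"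
      by simp
    also have "\<dots> = real (n k) / 2"
      using elim by (simp add: powr_diff)
    finally have "real (2 * 2 ^ a\<^sub>1 k) \<le> real (n k)"
      by (simp add: powr_realpow)
    then have half: "2 * 2 ^ a\<^sub>1 k \<le> n k"
      by (simp only: of_nat_le_iff)
    have "real (a\<^sub>2 k) \<le> (1 - e) * L k"
      unfolding a\<^sub>2_def using Lpos e by (simp add: of_nat_floor)
    then have "exp (- (1 + e) * ((1 - e) * L k)) \<le> miss ^ a\<^sub>2 k"
      using miss_gt e by (intro power_ge_exp) auto
    \<comment> \<open>Since (1 + e)(1 - e) = 1 - e^2, the expected number of survivors is still of
      order at least n^(e^2), which tends to infinity.\<close>
    then have "exp (- (1 + e) * ((1 - e) * L k)) * exp (L k) \<le> miss ^ a\<^sub>2 k * real (n k)"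
      unfolding nk by (rule mult_right_mono) simp
    also have "exp (- (1 + e) * ((1 - e) * L k)) * exp (L k) = exp (e * e * L k)"
      by (simp add: algebra_simps flip: exp_add)
    finally have "exp (e * e * L k) \<le> miss ^ a\<^sub>2 k * real (n k)" .
    then have "2 / (miss ^ a\<^sub>2 k * real (n k)) \<le> 2 / exp (e * e * L k)"
      using miss_pos nk by (intro divide_left_mono) auto
    also have "\<dots> = 2 * exp (- (e * e) * L k)"
      by (simp add: exp_minus field_simps)
    finally show ?case
      using prob_all_informed_le[OF _ miss_pos half, of "v k" "a\<^sub>2 k"] elim by (simp add: a_def)
  qed
  have "(\<lambda>k. measure_pmf.prob (run_pmf (round_choice (n k) (E k)) (\<lambda>S f. S \<union> f ` S) {v k} (a k))
      {S. {0..<n k} \<subseteq> S}) \<longlonglongrightarrow> 0"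
    by (rule tendsto_sandwich[OF _ le tendsto_const F]) auto
  with le_a show thesis
    by (rule that)
qed

theorem theorem2:
  fixes C :: real
    and n :: "nat \<Rightarrow> nat" and E :: "nat \<Rightarrow> nat \<Rightarrow> nat \<Rightarrow> bool"
    and d :: "nat \<Rightarrow> nat" and v :: "nat \<Rightarrow> nat"
  assumes "C > 0"
    and "filterlim n at_top sequentially"
    and "eventually (\<lambda>k. simple_graph (n k) (E k) \<and> connected_graph (n k) (E k)
            \<and> regular (n k) (E k) (d k)
            \<and> second_eig (n k) (E k) \<le> C * sqrt (d k)
            \<and> real (d k) \<ge> 2 * C * sqrt (n k * ln (n k) powr (1/9))
            \<and> v k < n k) sequentially"
  shows "\<forall>\<epsilon>>0. (\<lambda>k. measure (push_space (n k) (E k))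
            {\<omega> \<in> space (push_space (n k) (E k)).
               push_time (n k) (v k) \<omega> \<noteq> \<infinity> \<and>
               \<bar>real (the_enat (push_time (n k) (v k) \<omega>)) - (log 2 (n k) + ln (n k))\<bar>
                 \<le> \<epsilon> * ln (n k)}) \<longlonglongrightarrow> 1"
proof (intro allI impI)
  fix \<epsilon> :: real assume "\<epsilon> > 0"
  let ?P = "\<lambda>k m. \<bar>real m - (log 2 (n k) + ln (n k))\<bar> \<le> \<epsilon> * ln (n k)"
  have d: "filterlim d at_top sequentially"
    using eventually_mono[OF assms(3)] by (intro degree_tendsto_at_top[OF assms(1,2)]) simp
  have ev: "eventually (\<lambda>k. expander (n k) (E k) (d k) (C / sqrt (d k)) \<and> v k < n k) sequentially"
    using assms(3) filterlim_at_top[THEN iffD1, OF assms(2), rule_format, of 2]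
      filterlim_at_top[THEN iffD1, OF d, rule_format, of 1]
  proof eventually_elim
    case (elim k)
    then show ?case
      using assms(1) by (auto intro!: expander_of_second_eig)
  qed
  then have reg: "eventually (\<lambda>k. regular_graph (n k) (E k) (d k) \<and> v k < n k) sequentially"
    by eventually_elim (simp add: expander_def)
  obtain b where b: "eventually (\<lambda>k. real (b k) \<le> log 2 (n k) + ln (n k) + \<epsilon> * ln (n k)) sequentially"
    and upper: "(\<lambda>k. measure_pmf.prob (run_pmf (round_choice (n k) (E k)) (\<lambda>S f. S \<union> f ` S) {v k} (b k))
      (- {{0..<n k}})) \<longlonglongrightarrow> 0"
    using push_time_upper_tail[OF assms(1) \<open>\<epsilon> > 0\<close> assms(2) d ev] by blast
  obtain a where a: "eventually (\<lambda>k. log 2 (n k) + ln (n k) - \<epsilon> * ln (n k) \<le> real (a k)) sequentially"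
    and lower: "(\<lambda>k. measure_pmf.prob (run_pmf (round_choice (n k) (E k)) (\<lambda>S f. S \<union> f ` S) {v k} (a k))
      {S. {0..<n k} \<subseteq> S}) \<longlonglongrightarrow> 0"
    using push_time_lower_tail[OF \<open>\<epsilon> > 0\<close> assms(2) d reg] by blast
  show "(\<lambda>k. measure (push_space (n k) (E k))
            {\<omega> \<in> space (push_space (n k) (E k)).
               push_time (n k) (v k) \<omega> \<noteq> \<infinity> \<and> ?P k (the_enat (push_time (n k) (v k) \<omega>))}) \<longlonglongrightarrow> 1"
  \<comment> \<open>The probability is squeezed between 1 minus the two tails and 1.\<close>
  proof (rule tendsto_sandwich)
    show "(\<lambda>k. 1 - measure_pmf.prob (run_pmf (round_choice (n k) (E k)) (\<lambda>S f. S \<union> f ` S) {v k} (b k))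
          (- {{0..<n k}})
        - measure_pmf.prob (run_pmf (round_choice (n k) (E k)) (\<lambda>S f. S \<union> f ` S) {v k} (a k))
          {S. {0..<n k} \<subseteq> S}) \<longlonglongrightarrow> 1"
      using tendsto_diff[OF tendsto_diff[OF tendsto_const upper] lower, of 1] by simp
    show "eventually (\<lambda>k. 1 - measure_pmf.prob (run_pmf (round_choice (n k) (E k)) (\<lambda>S f. S \<union> f ` S) {v k} (b k))
          (- {{0..<n k}})
        - measure_pmf.prob (run_pmf (round_choice (n k) (E k)) (\<lambda>S f. S \<union> f ` S) {v k} (a k))
          {S. {0..<n k} \<subseteq> S}
        \<le> measure (push_space (n k) (E k))
            {\<omega> \<in> space (push_space (n k) (E k)).
               push_time (n k) (v k) \<omega> \<noteq> \<infinity> \<and> ?P k (the_enat (push_time (n k) (v k) \<omega>))}) sequentially"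
      using a b
    proof eventually_elim
      case (elim k)
      have "?P k m" if "a k < m" "m \<le> b k" for m
        using that elim by (simp add: abs_le_iff)
      then show ?case
        by (rule prob_push_time_ge)
    qed
    show "eventually (\<lambda>k. measure (push_space (n k) (E k))
            {\<omega> \<in> space (push_space (n k) (E k)).
               push_time (n k) (v k) \<omega> \<noteq> \<infinity> \<and> ?P k (the_enat (push_time (n k) (v k) \<omega>))} \<le> 1) sequentially"
      unfolding push_space_def
      by (intro always_eventually allI prob_space.prob_le_1 prob_space.prob_space_stream_space
          measure_pmf.prob_space_axioms)
  qed simp
qed

end
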